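(* For every alphabet $\Sigma$, the classes $\mathcal{G}_{\mathrm{bnd},\Sigma}$, $\mathcal{G}_{\mathrm{pbnd},\Sigma}$, $\mathcal{G}_{\mathrm{lin},\Sigma}$, $\mathcal{G}_{\mathrm{plin},\Sigma}$, $\mathcal{G}_{\mathrm{bnd}}$, $\mathcal{G}_{\mathrm{pbnd}}$, $\mathcal{G}_{\mathrm{lin}}$, $\mathcal{G}_{\mathrm{plin}}$ all coincide (as classes of groups up to isomorphism).
   Context: An alphabet is a finite set with at least two elements. For the full shift $\Sigma^{\mathbb{Z}}$ with shift $\sigma(x)_i=x_{i+1}$, $\llbracket\Sigma^{\mathbb{Z}}\rrbracket$ is the group of homeomorphisms $f$ with a continuous cocycle $c:\Sigma^{\mathbb{Z}}\to\mathbb{Z}$ such that $f(x)=\sigma^{c(x)}(x)$. Write $[w]_i=\{x:x_{[i,i+|w|-1]}=w\}$. A subgroup $G\le\llbracket\Sigma^{\mathbb{Z}}\rrbracket$ has look-ahead $\alpha:\mathbb{N}\to\mathbb{N}$ if $\alpha(0)=0$ and for every non-identity $g\in G$ with cocycle $c$ there exist $n\ge1$, $w\in\Sigma^{2n+1}$ and $m\in\mathbb{Z}$ with $c(x)=m$ for all $x\in[w]_{-n}$ and $|m|+\alpha(|m|)\ge n$; it has plook-ahead $\alpha$ if $\alpha(0)=0$ and for every non-identity $g\in G$ with cocycle $c$ there are $n\ge1$ and a point $x$ with $\sigma^p(x)=x$ for some $1\le p\le 2n+1$ and $|c(x)|+\alpha(|c(x)|)\ge n$. $\alpha$ is linear if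 there is $C\in\mathbb{N}$ with $\alpha(n)\le Cn+C$ for all $n$, and bounded if it is a bounded function. $\mathcal{G}_{\mathrm{bnd},\Sigma}$ (resp. $\mathcal{G}_{\mathrm{lin},\Sigma}$, $\mathcal{G}_{\mathrm{pbnd},\Sigma}$, $\mathcal{G}_{\mathrm{plin},\Sigma}$) is the class of groups isomorphic to a subgroup of $\llbracket\Sigma^{\mathbb{Z}}\rrbracket$ having some bounded look-ahead (resp. linear look-ahead, bounded plook-ahead, linear plook-ahead). The classes without subscript $\Sigma$ are the unions over all alphabets $\Sigma$. *)

theory Defs
  imports "HOL-Analysis.Analysis" "HOL-Algebra.Group"
begin

definition shift_space :: "'a set \<Rightarrow> (int \<Rightarrow> 'a) set" where
  "shift_space S = {x. \<forall>i. x i \<in> S}"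

definition shift_top :: "'a set \<Rightarrow> (int \<Rightarrow> 'a) topology" where
  "shift_top S = product_topology (\<lambda>i::int. discrete_topology S) UNIV"

definition shiftpow :: "int \<Rightarrow> (int \<Rightarrow> 'a) \<Rightarrow> (int \<Rightarrow> 'a)" where
  "shiftpow k x = (\<lambda>i. x (i + k))"

definition is_cocycle :: "'a set \<Rightarrow> ((int \<Rightarrow> 'a) \<Rightarrow> (int \<Rightarrow> 'a)) \<Rightarrow> ((int \<Rightarrow> 'a) \<Rightarrow> int) \<Rightarrow> bool" where
  "is_cocycle S f c \<longleftrightarrow>
     continuous_map (shift_top S) (discrete_topology (UNIV::int set)) c \<and>
     (\<forall>x\<in>shift_space S. f x = shiftpow (c x) x)"

definition TFG :: "'a set \<Rightarrow> ((int \<Rightarrow> 'a) \<Rightarrow> (int \<Rightarrow> 'a)) monoid" where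
  "TFG S = \<lparr> carrier = {f. f \<in> extensional (shift_space S) \<and>
                             homeomorphic_map (shift_top S) (shift_top S) f \<and>
                             (\<exists>c. is_cocycle S f c)},
            mult = (\<lambda>g f. compose (shift_space S) g f),
            one = restrict id (shift_space S) \<rparr>"

definition cylinder :: "'a set \<Rightarrow> 'a list \<Rightarrow> int \<Rightarrow> (int \<Rightarrow> 'a) set" where
  "cylinder S w i = {x \<in> shift_space S. \<forall>k < length w. x (i + int k) = w ! k}"

definition has_lookahead ::
  "'a set \<Rightarrow> ((int \<Rightarrow> 'a) \<Rightarrow> (int \<Rightarrow> 'a)) set \<Rightarrow> (nat \<Rightarrow> nat) \<Rightarrow> bool" where
  "has_lookahead S H \<alpha> \<longleftrightarrow> \<alpha> 0 = 0 \<and>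
     (\<forall>g\<in>H. g \<noteq> \<one>\<^bsub>TFG S\<^esub> \<longrightarrow> (\<forall>c. is_cocycle S g c \<longrightarrow>
        (\<exists>n::nat. n \<ge> 1 \<and> (\<exists>w. length w = 2*n+1 \<and> set w \<subseteq> S \<and> (\<exists>m::int.
            (\<forall>x\<in>cylinder S w (- int n). c x = m) \<and>
            nat \<bar>m\<bar> + \<alpha> (nat \<bar>m\<bar>) \<ge> n)))))"

definition has_plookahead ::
  "'a set \<Rightarrow> ((int \<Rightarrow> 'a) \<Rightarrow> (int \<Rightarrow> 'a)) set \<Rightarrow> (nat \<Rightarrow> nat) \<Rightarrow> bool" where
  "has_plookahead S H \<alpha> \<longleftrightarrow> \<alpha> 0 = 0 \<and>
     (\<forall>g\<in>H. g \<noteq> \<one>\<^bsub>TFG S\<^esub> \<longrightarrow> (\<forall>c. is_cocycle S g c \<longrightarrow>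
        (\<exists>n::nat. n \<ge> 1 \<and> (\<exists>x\<in>shift_space S. \<exists>p::nat. 1 \<le> p \<and> p \<le> 2*n+1 \<and>
            shiftpow (int p) x = x \<and>
            nat \<bar>c x\<bar> + \<alpha> (nat \<bar>c x\<bar>) \<ge> n))))"

definition linear_fun :: "(nat \<Rightarrow> nat) \<Rightarrow> bool" where
  "linear_fun \<alpha> \<longleftrightarrow> (\<exists>C::nat. \<forall>n. \<alpha> n \<le> C * n + C)"

definition bounded_fun :: "(nat \<Rightarrow> nat) \<Rightarrow> bool" where
  "bounded_fun \<alpha> \<longleftrightarrow> (\<exists>B::nat. \<forall>n. \<alpha> n \<le> B)"

definition in_class ::
  "((nat \<Rightarrow> nat) \<Rightarrow> bool) \<Rightarrow>
   ('a set \<Rightarrow> ((int \<Rightarrow> 'a) \<Rightarrow> (int \<Rightarrow> 'a)) set \<Rightarrow> (nat \<Rightarrow> nat) \<Rightarrow> bool) \<Rightarrow>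
   'a set \<Rightarrow> ('g, 'b) monoid_scheme \<Rightarrow> bool" where
  "in_class P LA S G \<longleftrightarrow>
     (\<exists>H \<alpha>. subgroup H (TFG S) \<and> P \<alpha> \<and> LA S H \<alpha> \<and> G \<cong> (TFG S)\<lparr>carrier := H\<rparr>)"

definition G_bnd :: "'a set \<Rightarrow> ('g, 'b) monoid_scheme \<Rightarrow> bool" where
  "G_bnd S G = in_class bounded_fun has_lookahead S G"
definition G_lin :: "'a set \<Rightarrow> ('g, 'b) monoid_scheme \<Rightarrow> bool" where
  "G_lin S G = in_class linear_fun has_lookahead S G"
definition G_pbnd :: "'a set \<Rightarrow> ('g, 'b) monoid_scheme \<Rightarrow> bool" where
  "G_pbnd S G = in_class bounded_fun has_plookahead S G"
definition G_plin :: "'a set \<Rightarrow> ('g, 'b) monoid_scheme \<Rightarrow> bool" where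
  "G_plin S G = in_class linear_fun has_plookahead S G"

definition alphabet :: "'a set \<Rightarrow> bool" where
  "alphabet S \<longleftrightarrow> finite S \<and> card S \<ge> 2"

text \<open>Unions over all alphabets. Every alphabet is in bijection with a finite set of
naturals, and all notions are invariant under renaming letters, so alphabets are
taken to be subsets of nat.\<close>
definition G_bnd_all :: "('g, 'b) monoid_scheme \<Rightarrow> bool" where
  "G_bnd_all G \<longleftrightarrow> (\<exists>S::nat set. alphabet S \<and> G_bnd S G)"
definition G_lin_all :: "('g, 'b) monoid_scheme \<Rightarrow> bool" where
  "G_lin_all G \<longleftrightarrow> (\<exists>S::nat set. alphabet S \<and> G_lin S G)"
definition G_pbnd_all :: "('g, 'b) monoid_scheme \<Rightarrow> bool" where
  "G_pbnd_all G \<longleftrightarrow> (\<exists>S::nat set. alphabet S \<and> G_pbnd S G)"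
definition G_plin_all :: "('g, 'b) monoid_scheme \<Rightarrow> bool" where
  "G_plin_all G \<longleftrightarrow> (\<exists>S::nat set. alphabet S \<and> G_plin S G)"

end

theory Submission
  imports Defs
begin

text \<open>Filling up a window periodically turns look-ahead into plook-ahead, so all classes lie between
  \<open>G_bnd\<close> and \<open>G_plin\<close>, and a group with linear plook-ahead over an alphabet \<open>A\<close> has to be realized
  with bounded look-ahead over an arbitrary alphabet \<open>S\<close>. Points over \<open>S\<close> are parsed into conveyor
  belts: runs of adjacent cells, each cell carrying one letter of \<open>A\<close> on a lane moving right and a
  bounded number of letters on a lane moving left. Moving one node along the belt is an element \<open>\<tau>\<close>
  of the full group over \<open>S\<close>, and \<open>g\<close> acts by \<open>y \<mapsto> \<tau>^(c_g (t y)) y\<close>, where \<open>t y\<close> is the sequence of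
  letters read along the belt. Linear plook-ahead provides for \<open>g \<noteq> 1\<close> a periodic point \<open>x\<close> of period
  \<open>O(\<bar>c_g x\<bar>)\<close>. As the density of the left-moving lane is adjustable, a multiple of that period fits on
  a belt of exactly \<open>\<bar>c_g x\<bar>\<close> cells, and \<open>g\<close> moves one end of it to the other end. This distance
  is, up to an additive constant, the radius of a window that shows the whole belt.\<close>

section \<open>Cocycles and the topological full group\<close>

definition agree_on :: "nat \<Rightarrow> (int \<Rightarrow> 'a) \<Rightarrow> (int \<Rightarrow> 'a) \<Rightarrow> bool" where
  "agree_on N x y \<longleftrightarrow> (\<forall>i. \<bar>i\<bar> \<le> int N \<longrightarrow> x i = y i)"

definition loc_const :: "'a set \<Rightarrow> ((int \<Rightarrow> 'a) \<Rightarrow> 'c) \<Rightarrow> bool" where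
  "loc_const S c \<longleftrightarrow> (\<forall>x\<in>shift_space S. \<exists>N. \<forall>y\<in>shift_space S. agree_on N x y \<longrightarrow> c y = c x)"

lemma agree_on_mono: "agree_on N x y \<Longrightarrow> N' \<le> N \<Longrightarrow> agree_on N' x y"
  by (auto simp: agree_on_def)

lemma topspace_shift_top [simp]: "topspace (shift_top S) = shift_space S"
  by (auto simp: shift_top_def shift_space_def PiE_def extensional_def Pi_def)

text \<open>A basic open set of the product topology constrains finitely many coordinates, and these
  lie in some central window; conversely each window cuts out a basic open set.\<close>

lemma continuous_discrete_iff:
  "continuous_map (shift_top S) (discrete_topology D) c \<longleftrightarrow> c ` shift_space S \<subseteq> D \<and> loc_const S c"
proof safe
  fix x assume c: "continuous_map (shift_top S) (discrete_topology D) c" and x: "x \<in> shift_space S"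
  then show "c x \<in> D" using continuous_map_image_subset_topspace by fastforce
next
  assume c: "continuous_map (shift_top S) (discrete_topology D) c"
  show "loc_const S c" unfolding loc_const_def
  proof
    fix x assume x: "x \<in> shift_space S"
    have "c x \<in> D" using c x continuous_map_image_subset_topspace by fastforce
    then have "openin (shift_top S) {y \<in> topspace (shift_top S). c y \<in> {c x}}"
      by (intro openin_continuous_map_preimage[OF c]) auto
    then have "openin (shift_top S) {y \<in> shift_space S. c y = c x}" by simp
    moreover have "x \<in> {y \<in> shift_space S. c y = c x}" using x by simp
    ultimately have "\<exists>U. finite {i \<in> UNIV. U i \<noteq> topspace (discrete_topology S)} \<and>
        (\<forall>i\<in>UNIV. openin (discrete_topology S) (U i)) \<and> x \<in> PiE UNIV U \<and>
        PiE UNIV U \<subseteq> {y \<in> shift_space S. c y = c x}"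
      unfolding shift_top_def openin_product_topology_alt by blast
    then obtain U where U: "finite {i. U i \<noteq> S}" "x \<in> PiE UNIV U" 
        "PiE UNIV U \<subseteq> {y \<in> shift_space S. c y = c x}"
      by auto
    obtain N where N: "\<forall>i\<in>{i. U i \<noteq> S}. nat \<bar>i\<bar> \<le> N"
      using finite_nat_set_iff_bounded_le[of "(\<lambda>i. nat \<bar>i\<bar>) ` {i. U i \<noteq> S}"] U(1) by auto
    have "c y = c x" if y: "y \<in> shift_space S" "agree_on N x y" for y
    proof -
      have "y i \<in> U i" for i
      proof (cases "U i = S")
        case True then show ?thesis using y by (auto simp: shift_space_def)
      next
        case False
        then have "\<bar>i\<bar> \<le> int N" using N by force
        then have "x i = y i" using y by (auto simp: agree_on_def)
        then show ?thesis using U(2) by (metis PiE_mem UNIV_I)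
      qed
      then have "y \<in> PiE UNIV U" by (auto simp: PiE_def)
      then show ?thesis using U(3) by auto
    qed
    then show "\<exists>N. \<forall>y\<in>shift_space S. agree_on N x y \<longrightarrow> c y = c x" by blast
  qed
next
  assume D: "c ` shift_space S \<subseteq> D" and lc: "loc_const S c"
  show "continuous_map (shift_top S) (discrete_topology D) c"
    unfolding continuous_map_def
  proof (intro conjI allI impI)
    show "c \<in> topspace (shift_top S) \<rightarrow> topspace (discrete_topology D)" using D by auto
    fix V
    show "openin (shift_top S) {x \<in> topspace (shift_top S). c x \<in> V}"
    proof (subst openin_subopen, safe)
      fix x assume x: "x \<in> topspace (shift_top S)" "c x \<in> V"
      then obtain N where N: "\<And>y. y \<in> shift_space S \<Longrightarrow> agree_on N x y \<Longrightarrow> c y = c x"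
        using lc unfolding loc_const_def by (metis topspace_shift_top)
      let ?U = "PiE UNIV (\<lambda>i. if \<bar>i\<bar> \<le> int N then {x i} else S)"
      have fin: "finite {i. \<bar>i\<bar> \<le> int N}"
        by (rule finite_subset[of _ "{- int N..int N}"]) auto
      have op: "openin (shift_top S) ?U"
        unfolding shift_top_def
        using x by (intro product_topology_basis)
          (auto simp: shift_space_def intro: finite_subset[OF _ fin])
      have "?U \<subseteq> {x \<in> topspace (shift_top S). c x \<in> V}"
      proof
        fix y assume y: "y \<in> ?U"
        then have *: "y i \<in> (if \<bar>i\<bar> \<le> int N then {x i} else S)" for i by (rule PiE_mem) simp
        have ag: "agree_on N x y" using * by (auto simp: agree_on_def) (metis singletonD)
        have yi: "y i \<in> S" for i using * [of i] x by (auto simp: shift_space_def split: if_splits)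
        then have ys: "y \<in> shift_space S" by (auto simp: shift_space_def)
        then show "y \<in> {x \<in> topspace (shift_top S). c x \<in> V}" using N[OF ys ag] x by auto
      qed
      moreover have "x \<in> ?U" using x by (auto simp: shift_space_def)
      ultimately show "\<exists>T. openin (shift_top S) T \<and> x \<in> T \<and> T \<subseteq> {x \<in> topspace (shift_top S). c x \<in> V}"
        using op by blast
    qed
  qed
qed

section \<open>Shifts and cocycles in terms of windows\<close>

lemma shiftpow_add: "shiftpow i (shiftpow j x) = shiftpow (i + j) x"
  by (simp add: shiftpow_def add.assoc)

lemma shiftpow_0 [simp]: "shiftpow 0 x = x"
  by (simp add: shiftpow_def)

lemma shiftpow_in [simp]: "shiftpow k x \<in> shift_space S \<longleftrightarrow> x \<in> shift_space S"
  unfolding shift_space_def shiftpow_def by (auto, metis diff_add_cancel)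

lemma cocycle_alt:
  "is_cocycle S f c \<longleftrightarrow> loc_const S c \<and> (\<forall>x\<in>shift_space S. f x = shiftpow (c x) x)"
  by (simp add: is_cocycle_def continuous_discrete_iff)

lemma continuous_into_shift:
  "continuous_map (shift_top S) (shift_top A) f \<longleftrightarrow>
     f ` shift_space S \<subseteq> shift_space A \<and> (\<forall>i. loc_const S (\<lambda>x. f x i))"
  unfolding shift_top_def[of A] continuous_map_componentwise_UNIV continuous_discrete_iff
  by (auto simp: shift_space_def)

lemma continuous_loc_const:
  assumes f: "f ` shift_space S \<subseteq> shift_space A" "\<And>i. loc_const S (\<lambda>x. f x i)" and c: "loc_const A c"
  shows "loc_const S (\<lambda>x. c (f x))"
proof -
  have "continuous_map (shift_top S) (discrete_topology UNIV) (c \<circ> f)"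
    by (rule continuous_map_compose[of _ "shift_top A"])
      (use f c in \<open>auto simp: continuous_into_shift continuous_discrete_iff\<close>)
  then show ?thesis by (simp add: continuous_discrete_iff comp_def)
qed

text \<open>Near a point the parameter \<open>c x\<close> is frozen, so only one member of the
  family \<open>F\<close> matters there. This handles shifts and powers by an amount that itself
  depends on the point.\<close>

lemma loc_const_dep:
  assumes c: "loc_const S c" and F: "\<And>i. loc_const S (F i)"
  shows "loc_const S (\<lambda>x. F (c x) x)"
  unfolding loc_const_def
proof
  fix x assume x: "x \<in> shift_space S"
  obtain N where N: "\<And>y. y \<in> shift_space S \<Longrightarrow> agree_on N x y \<Longrightarrow> c y = c x"
    using c x unfolding loc_const_def by blast
  obtain N' where N': "\<And>y. y \<in> shift_space S \<Longrightarrow> agree_on N' x y \<Longrightarrow> F (c x) y = F (c x) x"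
    using F x unfolding loc_const_def by blast
  show "\<exists>N. \<forall>y\<in>shift_space S. agree_on N x y \<longrightarrow> F (c y) y = F (c x) x"
    using N N' by (intro exI[of _ "max N N'"]) (metis agree_on_mono max.cobounded1 max.cobounded2)
qed

lemma loc_const_const [simp]: "loc_const S (\<lambda>x. a)"
  by (simp add: loc_const_def)

lemma loc_const_comp: "loc_const S c \<Longrightarrow> loc_const S (\<lambda>x. h (c x))"
  unfolding loc_const_def by metis

lemma loc_const_coord [simp]: "loc_const S (\<lambda>x. x k)"
  unfolding loc_const_def agree_on_def by (metis abs_ge_zero nat_0_le order_refl)

lemma loc_const_comp2: "loc_const S c \<Longrightarrow> loc_const S d \<Longrightarrow> loc_const S (\<lambda>x. h (c x) (d x))"
  by (rule loc_const_dep[of S c "\<lambda>i x. h i (d x)"]) (auto intro: loc_const_comp)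

lemma loc_const_shift_dep:
  assumes "loc_const S c"
  shows "loc_const S (\<lambda>x. shiftpow (c x) x i)"
  using loc_const_dep[OF assms, of "\<lambda>k x. x (i + k)"] by (simp add: shiftpow_def)

lemma loc_const_cong:
  assumes "loc_const S c" "\<And>x. x \<in> shift_space S \<Longrightarrow> c x = d x"
  shows "loc_const S d"
  using assms unfolding loc_const_def by metis

text \<open>If \<open>c x\<close> and \<open>m\<close> differed, every point sharing a large window
  with \<open>x\<close> would repeat itself at distance \<open>\<bar>c x - m\<bar>\<close>, which a
  suitable choice of letters outside the window prevents.\<close>

lemma cocycle_unique_local:
  assumes S: "alphabet S" and c: "is_cocycle S f c"
    and f: "\<And>y. y \<in> shift_space S \<Longrightarrow> agree_on n x y \<Longrightarrow> f y = shiftpow m y"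
    and x: "x \<in> shift_space S"
  shows "c x = m"
proof (rule ccontr)
  assume ne: "c x \<noteq> m"
  obtain N where N: "\<And>y. y \<in> shift_space S \<Longrightarrow> agree_on N x y \<Longrightarrow> c y = c x"
    using c x unfolding cocycle_alt loc_const_def by blast
  have "\<exists>a\<in>S. \<exists>b\<in>S. a \<noteq> b"
    using S unfolding alphabet_def by (metis card_le_Suc0_iff_eq not_less_eq_eq numeral_2_eq_2)
  then obtain a b where ab: "a \<in> S" "b \<in> S" "a \<noteq> b" by blast
  define R where "R = int (max n N)"
  define d where "d = \<bar>c x - m\<bar>"
  \<comment> \<open>The positions \<open>R + 1\<close> and \<open>R + 1 + d\<close> outside the
    window receive different letters, which violates the period \<open>d\<close>.\<close>
  define y where "y = (\<lambda>i. if \<bar>i\<bar> \<le> R then x i else if i = R + 1 + d then b else a)"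
  have y: "y \<in> shift_space S" using ab x by (auto simp: y_def shift_space_def)
  have ag: "agree_on n x y" "agree_on N x y" by (auto simp: y_def agree_on_def R_def)
  have "shiftpow (c x) y = shiftpow m y"
    using f[OF y ag(1)] N[OF y ag(2)] c y unfolding cocycle_alt by metis
  then have per: "y (i + c x) = y (i + m)" for i unfolding shiftpow_def by metis
  have R: "R \<ge> 0" by (simp add: R_def)
  have d: "d > 0" using ne by (simp add: d_def)
  have "y (R + 1) = y (R + 1 + d)"
  proof (cases "c x > m")
    case True
    then show ?thesis using per[of "R + 1 - m"] by (simp add: d_def algebra_simps)
  next
    case False
    then show ?thesis using per[of "R + 1 - c x"] by (simp add: d_def algebra_simps)
  qed
  then show False using R d ab by (simp add: y_def split: if_splits)
qed

text \<open>Ensures that the quantification over all cocycles in the look-ahead conditions concerns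
  a single function on the shift space.\<close>

lemma cocycle_unique:
  assumes "alphabet S" "is_cocycle S f c" "is_cocycle S f d" "x \<in> shift_space S"
  shows "c x = d x"
proof -
  obtain N where N: "\<And>y. y \<in> shift_space S \<Longrightarrow> agree_on N x y \<Longrightarrow> d y = d x"
    using assms unfolding cocycle_alt loc_const_def by blast
  show ?thesis
    by (rule cocycle_unique_local[OF assms(1,2) _ assms(4), of N])
      (use assms(3) N in \<open>auto simp: cocycle_alt\<close>)
qed

text \<open>A cocycle makes a map continuous, and a continuous bijection of a compact Hausdorff
  space is a homeomorphism.\<close>

lemma TFG_mem:
  assumes S: "alphabet S"
  shows "f \<in> carrier (TFG S) \<longleftrightarrow> f \<in> extensional (shift_space S) \<and>
    bij_betw f (shift_space S) (shift_space S) \<and> (\<exists>c. is_cocycle S f c)"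
proof -
  have "homeomorphic_map (shift_top S) (shift_top S) f"
    if b: "bij_betw f (shift_space S) (shift_space S)" and c: "is_cocycle S f c" for c
  proof (rule continuous_imp_homeomorphic_map)
    show "compact_space (shift_top S)"
      using S unfolding shift_top_def alphabet_def
      by (simp add: compact_space_product_topology compact_space_discrete_topology)
    show "Hausdorff_space (shift_top S)"
      unfolding shift_top_def by (simp add: Hausdorff_space_product_topology)
    have "loc_const S (\<lambda>x. f x i)" for i
      using c loc_const_shift_dep[of S c i] unfolding cocycle_alt
      by (auto elim!: loc_const_cong)
    then show "continuous_map (shift_top S) (shift_top S) f"
      using b by (auto simp: continuous_into_shift bij_betw_def)
    show "f ` topspace (shift_top S) = topspace (shift_top S)" "inj_on f (topspace (shift_top S))"
      using b by (auto simp: bij_betw_def)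
  qed
  moreover have "bij_betw f (shift_space S) (shift_space S)"
    if "homeomorphic_map (shift_top S) (shift_top S) f"
    using that unfolding homeomorphic_eq_everything_map by (simp add: bij_betw_def)
  ultimately show ?thesis unfolding TFG_def by auto
qed

lemma TFG_continuous:
  assumes S: "alphabet S" and f: "f \<in> carrier (TFG S)"
  shows "f ` shift_space S = shift_space S" "loc_const S (\<lambda>x. f x i)"
proof -
  show "f ` shift_space S = shift_space S" using f by (simp add: TFG_mem[OF S] bij_betw_def)
  have "continuous_map (shift_top S) (shift_top S) f"
    using f by (auto simp: TFG_def homeomorphic_imp_continuous_map)
  then show "loc_const S (\<lambda>x. f x i)" by (simp add: continuous_into_shift)
qed

section \<open>Group structure of the full group\<close>

lemma TFG_mult [simp]: "mult (TFG S) g f = compose (shift_space S) g f"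
  by (simp add: TFG_def)

lemma TFG_one [simp]: "one (TFG S) = restrict id (shift_space S)"
  by (simp add: TFG_def)

lemma cocycle_compose:
  assumes S: "alphabet S" and f: "f \<in> carrier (TFG S)" and cf: "is_cocycle S f c"
    and cg: "is_cocycle S g d"
  shows "is_cocycle S (compose (shift_space S) g f) (\<lambda>x. d (f x) + c x)"
  unfolding cocycle_alt
proof (intro conjI ballI)
  have "loc_const S (\<lambda>x. d (f x))"
    by (rule continuous_loc_const[of f S S])
      (use TFG_continuous[OF S f] cg in \<open>auto simp: cocycle_alt\<close>)
  then show "loc_const S (\<lambda>x. d (f x) + c x)"
    using cf by (auto simp: cocycle_alt intro: loc_const_comp2)
  fix x assume x: "x \<in> shift_space S"
  then have "f x \<in> shift_space S" using TFG_continuous[OF S f] by auto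
  then have "g (f x) = shiftpow (d (f x)) (f x)" using cg by (auto simp: cocycle_alt)
  also have "\<dots> = shiftpow (d (f x)) (shiftpow (c x) x)" using cf x by (auto simp: cocycle_alt)
  finally show "compose (shift_space S) g f x = shiftpow (d (f x) + c x) x"
    using x by (simp add: compose_eq shiftpow_add)
qed

lemma cocycle_one: "is_cocycle S (restrict id (shift_space S)) (\<lambda>_. 0)"
  by (simp add: cocycle_alt)

lemma group_TFG:
  assumes S: "alphabet S"
  shows "group (TFG S)"
proof (rule groupI)
  fix f g assume f: "f \<in> carrier (TFG S)" and g: "g \<in> carrier (TFG S)"
  show "f \<otimes>\<^bsub>TFG S\<^esub> g \<in> carrier (TFG S)"
    using f g cocycle_compose[OF S g] by (auto simp: TFG_mem[OF S] intro: bij_betw_compose)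
next
  show "\<one>\<^bsub>TFG S\<^esub> \<in> carrier (TFG S)"
    using cocycle_one by (auto simp: TFG_mem[OF S] bij_betw_def inj_on_def)
next
  fix f g h assume "f \<in> carrier (TFG S)" "g \<in> carrier (TFG S)" and h: "h \<in> carrier (TFG S)"
  show "f \<otimes>\<^bsub>TFG S\<^esub> g \<otimes>\<^bsub>TFG S\<^esub> h = f \<otimes>\<^bsub>TFG S\<^esub> (g \<otimes>\<^bsub>TFG S\<^esub> h)"
    using TFG_continuous(1)[OF S h] by (auto intro!: compose_assoc[symmetric])
next
  fix f assume f: "f \<in> carrier (TFG S)"
  then have "f \<in> extensional (shift_space S)" by (simp add: TFG_mem[OF S])
  then show "\<one>\<^bsub>TFG S\<^esub> \<otimes>\<^bsub>TFG S\<^esub> f = f" 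
    using TFG_continuous(1)[OF S f] by (auto simp: compose_def extensional_def fun_eq_iff)
next
  fix f assume f: "f \<in> carrier (TFG S)"
  have ext: "f \<in> extensional (shift_space S)" and b: "bij_betw f (shift_space S) (shift_space S)"
    using f by (auto simp: TFG_mem[OF S])
  obtain c where c: "is_cocycle S f c" using f by (auto simp: TFG_mem[OF S])
  define g where "g = restrict (inv_into (shift_space S) f) (shift_space S)"
  have gb: "bij_betw g (shift_space S) (shift_space S)"
    using bij_betw_inv_into[OF b] by (simp add: g_def cong: bij_betw_cong)
  have hm: "homeomorphic_map (shift_top S) (shift_top S) f" using f by (simp add: TFG_def)
  then obtain g' where g': "homeomorphic_maps (shift_top S) (shift_top S) f g'"
    using homeomorphic_map_maps by blast
  \<comment> \<open>\<open>g\<close> is the topological inverse made extensional, so it inherits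
    continuity of its coordinates from \<open>g'\<close>. Its cocycle will be the negated cocycle of
    \<open>f\<close> at the image point.\<close>
  have gg': "g y = g' y" if y: "y \<in> shift_space S" for y
  proof -
    have "g' y \<in> shift_space S" "f (g' y) = y" 
      using g' y by (auto simp: homeomorphic_maps_def continuous_map_def)
    then show ?thesis using y b by (metis g_def bij_betw_inv_into_left restrict_apply')
  qed
  have "loc_const S (\<lambda>x. g' x i)" for i
    using g' unfolding homeomorphic_maps_def continuous_into_shift by blast
  then have "loc_const S (\<lambda>x. g x i)" for i
    by (rule loc_const_cong) (simp only: gg')
  then have "loc_const S (\<lambda>x. c (g x))"
    using gb c by (intro continuous_loc_const[of g S S c]) (simp_all add: cocycle_alt bij_betw_def)
  then have lc: "loc_const S (\<lambda>x. - c (g x))" by (rule loc_const_comp)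
  have "g x = shiftpow (- c (g x)) x" if x: "x \<in> shift_space S" for x
  proof -
    have gx: "g x \<in> shift_space S" using gb x by (auto simp: bij_betw_def)
    have "x = f (g x)" using x b by (simp add: g_def bij_betw_inv_into_right)
    also have "\<dots> = shiftpow (c (g x)) (g x)" using gx c unfolding cocycle_alt by blast
    finally have "x = shiftpow (c (g x)) (g x)" .
    then have "shiftpow (- c (g x)) x = shiftpow (- c (g x)) (shiftpow (c (g x)) (g x))" by metis
    then show ?thesis by (simp add: shiftpow_add)
  qed
  then have "is_cocycle S g (\<lambda>x. - c (g x))" using lc unfolding cocycle_alt by blast
  then have "g \<in> carrier (TFG S)" using gb unfolding TFG_mem[OF S] by (auto simp: g_def)
  moreover have "g \<otimes>\<^bsub>TFG S\<^esub> f = \<one>\<^bsub>TFG S\<^esub>"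
    using b by (auto simp: g_def compose_def fun_eq_iff bij_betw_inv_into_left bij_betw_apply)
  ultimately show "\<exists>g\<in>carrier (TFG S). g \<otimes>\<^bsub>TFG S\<^esub> f = \<one>\<^bsub>TFG S\<^esub>" by blast
qed

section \<open>Conveyor belts\<close>

text \<open>One letter for the right-moving lane, followed by at least one and at most
  \<open>K - 1\<close> for the left-moving lane. For finite \<open>A\<close> there are finitely many
  such lists, so words of a common length can code them.\<close>

definition cells :: "'b set \<Rightarrow> nat \<Rightarrow> 'b list set" where
  "cells A K = {l. set l \<subseteq> A \<and> 2 \<le> length l \<and> length l \<le> K}"

text \<open>Codewords have to be recognizable in an arbitrary point without reference to an origin,
  since everything built from them must commute with the shift. \<open>K_le_M\<close> leaves room to
  attach every letter of a cell to a position of its own within the codeword.\<close>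

locale belt_code =
  fixes A :: "'b set" and K M :: nat and code :: "'b list \<Rightarrow> 'a list"
  assumes K_le_M: "K \<le> M"
    and no_overlap: "\<And>y k k' l l'. \<lbrakk>l \<in> cells A K; l' \<in> cells A K; \<bar>k - k'\<bar> < int M;
      \<And>i. i < M \<Longrightarrow> y (k + int i) = code l ! i; \<And>i. i < M \<Longrightarrow> y (k' + int i) = code l' ! i\<rbrakk>
      \<Longrightarrow> k = k' \<and> l = l'"
begin

definition reads :: "(int \<Rightarrow> 'a) \<Rightarrow> int \<Rightarrow> 'b list \<Rightarrow> bool" where
  "reads y k l \<longleftrightarrow> l \<in> cells A K \<and> (\<forall>i<M. y (k + int i) = code l ! i)"

text \<open>Letter \<open>t\<close> of a cell is attached to the position at offset \<open>t\<close>
  in its codeword, so a belt node is addressed by a plain integer and moving along the belt is a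
  shift.\<close>

definition node :: "(int \<Rightarrow> 'a) \<Rightarrow> int \<Rightarrow> 'b list \<Rightarrow> nat \<Rightarrow> bool" where
  "node y k l t \<longleftrightarrow> reads y (k - int t) l \<and> t < length l"

lemma reads_unique: "reads y k l \<Longrightarrow> reads y k' l' \<Longrightarrow> \<bar>k - k'\<bar> < int M \<Longrightarrow> k = k' \<and> l = l'"
  unfolding reads_def using no_overlap by blast

lemma reads_length: "reads y k l \<Longrightarrow> 2 \<le> length l \<and> length l \<le> M"
  using K_le_M by (auto simp: reads_def cells_def)

lemma node_unique:
  assumes "node y k l t" "node y k l' t'"
  shows "l = l' \<and> t = t'"
proof -
  have "t < M" "t' < M" using assms by (auto simp: node_def dest: reads_length)
  then have "\<bar>(k - int t) - (k - int t')\<bar> < int M" by linarith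
  then show ?thesis using assms reads_unique unfolding node_def by fastforce
qed

text \<open>A cell at \<open>k\<close> is a piece of a conveyor belt: its head lies on the lane moving to the right,
  its tail on the lane moving to the left, and belts turn around where no further cell is adjacent.\<close>
inductive step :: "(int \<Rightarrow> 'a) \<Rightarrow> int \<Rightarrow> int \<Rightarrow> bool" for y where
  right: "reads y k l \<Longrightarrow> reads y (k + int M) l' \<Longrightarrow> step y k (k + int M)"
| turn_right: "reads y k l \<Longrightarrow> (\<And>l'. \<not> reads y (k + int M) l') \<Longrightarrow> step y k (k + 1)"
| inner: "reads y k l \<Longrightarrow> 1 \<le> t \<Longrightarrow> t + 1 < length l \<Longrightarrow> step y (k + int t) (k + int t + 1)"
| left: "reads y k l \<Longrightarrow> reads y (k - int M) l' \<Longrightarrow> step y (k + int (length l) - 1) (k - int M + 1)"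
| turn_left: "reads y k l \<Longrightarrow> (\<And>l'. \<not> reads y (k - int M) l') \<Longrightarrow> step y (k + int (length l) - 1) k"
| stay: "(\<And>l t. \<not> node y k l t) \<Longrightarrow> step y k k"

text \<open>Rule inversion with every position measured from the source node, which determines its
  cell and offset and thereby the applicable rule.\<close>

lemma step_cases_from:
  assumes "step y k k'"
  obtains (right) l l' where "node y k l 0" "reads y (k + int M) l'" "k' = k + int M"
  | (turn_right) l where "node y k l 0" "\<forall>l'. \<not> reads y (k + int M) l'" "k' = k + 1"
  | (inner) l t where "node y k l t" "1 \<le> t" "t + 1 < length l" "k' = k + 1"
  | (left) l t l' where "node y k l t" "1 \<le> t" "t + 1 = length l" "reads y (k - int t - int M) l'"
      "k' = k - int t - int M + 1"
  | (turn_left) l t where "node y k l t" "1 \<le> t" "t + 1 = length l"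
      "\<forall>l'. \<not> reads y (k - int t - int M) l'" "k' = k - int t"
  | (stay) "\<forall>l t. \<not> node y k l t" "k' = k"
  using assms
proof cases
  case (right l l')
  then have "node y k l 0" using reads_length[of y k l] by (auto simp: node_def)
  then show thesis using that(1) right by blast
next
  case (turn_right l)
  then have "node y k l 0" using reads_length[of y k l] by (auto simp: node_def)
  then show thesis using that(2) turn_right by blast
next
  case (inner k0 l t)
  then have "node y k l t" by (simp add: node_def)
  then show thesis using that(3) inner by blast
next
  case (left k0 l l')
  then have len: "2 \<le> length l" using reads_length by blast
  define t where "t = length l - 1"
  have t: "t + 1 = length l" "1 \<le> t" using len by (auto simp: t_def)
  then have k: "k0 = k - int t" using left by linarith
  then have "node y k l t" using left(3) t unfolding node_def by simp
  moreover have "reads y (k - int t - int M) l'" "k' = k - int t - int M + 1" using left k by simp_all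
  ultimately show thesis using that(4) t by blast
next
  case (turn_left l)
  then have len: "2 \<le> length l" using reads_length by blast
  define t where "t = length l - 1"
  have t: "t + 1 = length l" "1 \<le> t" using len by (auto simp: t_def)
  then have k: "k' = k - int t" using turn_left by linarith
  then have "node y k l t" using turn_left(2) t unfolding node_def by simp
  moreover have "\<forall>l'. \<not> reads y (k - int t - int M) l'" using turn_left k by simp
  ultimately show thesis using that(5) t k by blast
next
  case stay
  then show thesis using that(6) by blast
qed

text \<open>The inversion measured from the target node. Heads are entered from the left neighbour
  or by a turn at the left end, offset \<open>1\<close> from the right neighbour or by a turn at the
  right end, larger offsets from within the cell.\<close>

lemma step_cases_to:
  assumes "step y k k'"
  obtains (right) l' l where "node y k' l' 0" "reads y (k' - int M) l" "k = k' - int M"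
  | (turn_right) l where "node y k' l 1" "\<forall>l'. \<not> reads y (k' - 1 + int M) l'" "k = k' - 1"
  | (inner) l t where "node y k' l t" "2 \<le> t" "k = k' - 1"
  | (left) l l' where "node y k' l' 1" "reads y (k' - 1 + int M) l"
      "k = k' - 1 + int M + int (length l) - 1"
  | (turn_left) l where "node y k' l 0" "\<forall>l'. \<not> reads y (k' - int M) l'" 
      "k = k' + int (length l) - 1"
  | (stay) "\<forall>l t. \<not> node y k' l t" "k = k'"
  using assms
proof cases
  case (right l l')
  then have "node y k' l' 0" using reads_length[of y k' l'] by (auto simp: node_def)
  moreover have "reads y (k' - int M) l" "k = k' - int M" using right by simp_all
  ultimately show thesis by (rule that(1))
next
  case (turn_right l)
  then have "node y k' l 1" using reads_length[of y k l] by (auto simp: node_def)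
  moreover have "\<forall>l'. \<not> reads y (k' - 1 + int M) l'" "k = k' - 1" using turn_right by simp_all
  ultimately show thesis by (rule that(2))
next
  case (inner k0 l t)
  then have "node y k' l (t + 1)" by (simp add: node_def)
  moreover have "2 \<le> t + 1" "k = k' - 1" using inner by simp_all
  ultimately show thesis by (rule that(3))
next
  case (left k0 l l')
  then have "node y k' l' 1" using reads_length[of y "k0 - int M" l'] by (auto simp: node_def)
  moreover have "reads y (k' - 1 + int M) l" "k = k' - 1 + int M + int (length l) - 1"
    using left by simp_all
  ultimately show thesis by (rule that(4))
next
  case (turn_left l)
  then have "node y k' l 0" using reads_length[of y k' l] by (auto simp: node_def)
  then show thesis using that(5) turn_left by blast
next
  case stay
  then show thesis using that(6) by blast
qed

lemma step_from_node:
  assumes s: "step y k k'" and n: "node y k l t"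
  shows "k' = (if t = 0 then (if \<exists>l'. reads y (k + int M) l' then k + int M else k + 1)
    else if t + 1 < length l then k + 1
    else if \<exists>l'. reads y (k - int t - int M) l' then k - int t - int M + 1 else k - int t)"
  using s
proof (cases rule: step_cases_from)
  case (right l0 l')
  then have "t = 0" using node_unique[OF n] by blast
  then show ?thesis using right by auto
next
  case (turn_right l0)
  then have "t = 0" using node_unique[OF n] by blast
  then show ?thesis using turn_right by auto
next
  case (inner l0 t0)
  then have "t0 = t" "l0 = l" using node_unique[OF n] by blast+
  then show ?thesis using inner by auto
next
  case (left l0 t0 l')
  then have "t0 = t" "l0 = l" using node_unique[OF n] by blast+
  then show ?thesis using left by auto
next
  case (turn_left l0 t0)
  then have "t0 = t" "l0 = l" using node_unique[OF n] by blast+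
  then show ?thesis using turn_left by auto
next
  case stay
  then show ?thesis using n by blast
qed

text \<open>The target node alone determines its predecessor, which gives injectivity. The
  \<open>THE\<close> is the right neighbour cell, whose length locates its last left-lane
  node.\<close>

lemma step_to_node:
  assumes s: "step y k' k" and n: "node y k l t"
  shows "k' = (if t = 0 then (if \<exists>l'. reads y (k - int M) l' then k - int M else k + int (length l) - 1)
    else if t = 1 \<and> (\<exists>l'. reads y (k - 1 + int M) l')
      then k - 1 + int M + int (length (THE l'. reads y (k - 1 + int M) l')) - 1
    else k - 1)"
  using s
proof (cases rule: step_cases_to)
  case (right l0 l')
  then have "t = 0" using node_unique[OF n] by blast
  then show ?thesis using right by auto
next
  case (turn_right l0)
  then have "t = 1" using node_unique[OF n] by blast
  then show ?thesis using turn_right by auto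
next
  case (inner l0 t0)
  then have "t0 = t" using node_unique[OF n] by blast
  then show ?thesis using inner by auto
next
  case (left l0 l')
  then have "t = 1" using node_unique[OF n] by blast
  moreover have "(THE l'. reads y (k - 1 + int M) l') = l0"
  proof (rule the_equality)
    show "reads y (k - 1 + int M) l0" by (fact left(2))
  next
    fix l1 assume r: "reads y (k - 1 + int M) l1"
    then have "0 < M" using reads_length by fastforce
    then show "l1 = l0" using reads_unique[OF r left(2)] by simp
  qed
  ultimately show ?thesis using left(2,3) by auto
next
  case (turn_left l0)
  then have "t = 0" "l0 = l" using node_unique[OF n] by blast+
  then show ?thesis using turn_left by auto
next
  case stay
  then show ?thesis using n by blast
qed

lemma step_no_node:
  assumes "step y k k'"
  shows "(\<forall>l t. \<not> node y k l t) \<longleftrightarrow> (\<forall>l t. \<not> node y k' l t)" 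
    and "(\<forall>l t. \<not> node y k l t) \<Longrightarrow> k' = k"
proof -
  show "(\<forall>l t. \<not> node y k l t) \<Longrightarrow> k' = k"
    using assms by (cases rule: step_cases_from) blast+
  moreover have "(\<forall>l t. \<not> node y k' l t) \<Longrightarrow> k' = k"
    using assms by (cases rule: step_cases_to) blast+
  ultimately show "(\<forall>l t. \<not> node y k l t) \<longleftrightarrow> (\<forall>l t. \<not> node y k' l t)" by blast
qed

lemma step_functional: 
  assumes 1: "step y k k1" and 2: "step y k k2"
  shows "k1 = k2"
proof (cases "\<exists>l t. node y k l t")
  case True
  then obtain l t where "node y k l t" by blast
  then show ?thesis using step_from_node[OF 1] step_from_node[OF 2] by simp
next
  case False
  then show ?thesis using step_no_node(2)[OF 1] step_no_node(2)[OF 2] by blast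
qed

lemma step_injective:
  assumes 1: "step y k1 k" and 2: "step y k2 k"
  shows "k1 = k2"
proof (cases "\<exists>l t. node y k l t")
  case True
  then obtain l t where "node y k l t" by blast
  then show ?thesis using step_to_node[OF 1] step_to_node[OF 2] by simp
next
  case False
  then show ?thesis using step_no_node[OF 1] step_no_node[OF 2] by metis
qed

lemma step_total: "\<exists>k'. step y k k'"
proof (cases "\<exists>l t. node y k l t")
  case False
  then show ?thesis using stay by blast
next
  case True
  then obtain l t where n: "reads y (k - int t) l" "t < length l" by (auto simp: node_def)
  then have len: "2 \<le> length l" using reads_length by blast
  consider "t = 0" | "1 \<le> t" "t + 1 < length l" | "1 \<le> t" "t + 1 = length l" using n(2) by linarith
  then show ?thesis
  proof cases
    case 1
    then show ?thesis using n right turn_right by (metis diff_zero of_nat_0)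
  next
    case 2
    then show ?thesis using inner[OF n(1) 2] by auto
  next
    case 3
    then have "k = k - int t + int (length l) - 1" by linarith
    then show ?thesis using left[OF n(1)] turn_left[OF n(1)] by metis
  qed
qed

lemma step_onto: "\<exists>k'. step y k' k"
proof (cases "\<exists>l t. node y k l t")
  case False
  then show ?thesis using stay by blast
next
  case True
  then obtain l t where n: "reads y (k - int t) l" "t < length l" by (auto simp: node_def)
  consider "t = 0" | "t = 1" | "2 \<le> t" by linarith
  then show ?thesis
  proof cases
    case 1
    then have r: "reads y k l" using n by simp
    show ?thesis using right[of y "k - int M" _ l] turn_left[OF r] r by fastforce
  next
    case 2
    then have r: "reads y (k - 1) l" using n by simp
    show ?thesis using left[of y "k - 1 + int M" _ l] turn_right[OF r] r by fastforce
  next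
    case 3
    then have "step y (k - int t + int (t - 1)) (k - int t + int (t - 1) + 1)" 
      using inner[OF n(1), of "t - 1"] n(2) by simp
    moreover have "k - int t + int (t - 1) + 1 = k" using 3 by simp
    ultimately show ?thesis by metis
  qed
qed

section \<open>Shift equivariance and locality of steps\<close>

lemma reads_shift: "reads (shiftpow j y) k l \<longleftrightarrow> reads y (k + j) l"
  by (simp add: reads_def shiftpow_def algebra_simps)

lemma node_shift: "node (shiftpow j y) k l t \<longleftrightarrow> node y (k + j) l t"
  by (simp add: node_def reads_shift algebra_simps)

lemma step_shift_imp: 
  assumes "step y k k'"
  shows "step (shiftpow j y) (k - j) (k' - j)"
  using assms
proof cases
  case (right l l')
  then show ?thesis using step.right[of "shiftpow j y" "k - j" l l'] by (simp add: reads_shift algebra_simps)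
next
  case (turn_right l)
  then show ?thesis using step.turn_right[of "shiftpow j y" "k - j" l] by (simp add: reads_shift algebra_simps)
next
  case (inner k0 l t)
  then show ?thesis using step.inner[of "shiftpow j y" "k0 - j" l t] by (simp add: reads_shift algebra_simps)
next
  case (left k0 l l')
  have "step (shiftpow j y) (k0 - j + int (length l) - 1) (k0 - j - int M + 1)"
    using left by (intro step.left[of _ _ _ l']) (simp_all add: reads_shift)
  moreover have "k0 - j + int (length l) - 1 = k - j" "k0 - j - int M + 1 = k' - j"
    using left by simp_all
  ultimately show ?thesis by metis
next
  case (turn_left l)
  then have "step (shiftpow j y) (k' - j + int (length l) - 1) (k' - j)"
    by (intro step.turn_left) (simp_all add: reads_shift)
  moreover have "k' - j + int (length l) - 1 = k - j" using turn_left by simp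
  ultimately show ?thesis by metis
next
  case stay
  then show ?thesis using step.stay[of "shiftpow j y" "k - j"] by (simp add: node_shift)
qed

text \<open>The rules inspect the cell containing \<open>k\<close> and one adjacent cell, and these
  codewords lie within distance \<open>2 * M\<close> of \<open>k\<close>.\<close>

lemma step_local:
  assumes s: "step y k k'" and eq: "\<And>i. \<bar>i - k\<bar> \<le> 2 * int M \<Longrightarrow> z i = y i"
  shows "step z k k'"
proof -
  have R: "reads z j l \<longleftrightarrow> reads y j l" if "k - 2 * int M \<le> j" "j \<le> k + int M" for j l
    using that eq unfolding reads_def by auto
  have N: "node z k l t \<longleftrightarrow> node y k l t" for l t
    using R[of "k - int t" l] reads_length[of y "k - int t" l] reads_length[of z "k - int t" l]
    unfolding node_def by fastforce
  from s show ?thesis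
  proof cases
    case (right l l')
    then show ?thesis using R by (auto intro: step.right)
  next
    case (turn_right l)
    then show ?thesis using R by (auto intro!: step.turn_right)
  next
    case (inner k0 l t)
    then have "reads z k0 l" using R[of k0 l] reads_length[of y k0 l] by simp
    then show ?thesis unfolding inner(1,2) using inner by (intro step.inner)
  next
    case (left k0 l l')
    then have "reads z k0 l" "reads z (k0 - int M) l'"
      using R[of k0 l] R[of "k0 - int M" l'] reads_length[of y k0 l] by simp_all
    then show ?thesis unfolding left(1,2) by (rule step.left)
  next
    case (turn_left l)
    then have "reads z k' l" "\<And>l'. \<not> reads z (k' - int M) l'"
      using R[of k' l] R[of "k' - int M"] reads_length[of y k' l] by simp_all
    then show ?thesis unfolding turn_left(1) by (rule step.turn_left)
  next
    case stay
    then show ?thesis using N by (auto intro: step.stay)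
  qed
qed

text \<open>The displacement from the origin is the cocycle of \<open>belt\<close>; equivariance
  reduces any other source to this one.\<close>

definition move :: "(int \<Rightarrow> 'a) \<Rightarrow> int" where
  "move y = (THE k. step y 0 k)"

lemma step_move: "step y 0 k \<longleftrightarrow> move y = k"
  unfolding move_def using step_functional step_total by (metis the_equality)

lemma step_iff_move: "step y k k' \<longleftrightarrow> move (shiftpow k y) = k' - k"
proof
  assume "step y k k'"
  then have "step (shiftpow k y) 0 (k' - k)" using step_shift_imp[of y k k' k] by simp
  then show "move (shiftpow k y) = k' - k" by (simp add: step_move)
next
  assume "move (shiftpow k y) = k' - k"
  then have "step (shiftpow k y) 0 (k' - k)" by (simp add: step_move)
  then have "step (shiftpow (- k) (shiftpow k y)) (0 - - k) (k' - k - - k)" by (rule step_shift_imp)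
  then show "step y k k'" by (simp add: shiftpow_add)
qed

text \<open>Since \<open>step\<close> is a permutation of the positions that commutes with shifts, following it
  from the origin gives an element of the full group.\<close>
definition belt :: "(int \<Rightarrow> 'a) \<Rightarrow> (int \<Rightarrow> 'a)" where
  "belt y = shiftpow (move y) y"

lemma belt_step: "step y k k' \<Longrightarrow> belt (shiftpow k y) = shiftpow k' y"
  by (simp add: belt_def step_iff_move shiftpow_add)

text \<open>Off all belts the default \<open>a0\<close> is read; as \<open>step\<close> fixes such
  positions, the simulated tape there is constantly \<open>a0\<close>.\<close>

definition letter :: "'b \<Rightarrow> (int \<Rightarrow> 'a) \<Rightarrow> 'b" where
  "letter a0 y = (if \<exists>l t. node y 0 l t then THE a. \<exists>l t. node y 0 l t \<and> a = l ! t else a0)"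

lemma letter_node:
  assumes "reads y k l" "t < length l"
  shows "letter a0 (shiftpow (k + int t) y) = l ! t"
proof -
  have n: "node (shiftpow (k + int t) y) 0 l t" using assms by (simp add: node_def reads_shift)
  have "(THE a. \<exists>l t'. node (shiftpow (k + int t) y) 0 l t' \<and> a = l ! t') = l ! t"
  proof (rule the_equality)
    show "\<exists>l' t'. node (shiftpow (k + int t) y) 0 l' t' \<and> l ! t = l' ! t'" using n by blast
  next
    fix a assume "\<exists>l t'. node (shiftpow (k + int t) y) 0 l t' \<and> a = l ! t'"
    then show "a = l ! t" using node_unique[OF n] by blast
  qed
  moreover have "\<exists>l t'. node (shiftpow (k + int t) y) 0 l t'" using n by blast
  ultimately show ?thesis unfolding letter_def by (simp only: if_True)
qed

lemma letter_in: 
  assumes "a0 \<in> A"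
  shows "letter a0 y \<in> A"
proof (cases "\<exists>l t. node y 0 l t")
  case True
  then obtain l t where n: "node y 0 l t" by blast
  then have "letter a0 y = l ! t" using letter_node[of y "- int t" l t] by (simp add: node_def)
  then show ?thesis using n by (auto simp: node_def reads_def cells_def)
next
  case False
  then show ?thesis using assms by (simp add: letter_def)
qed

lemma move_local: "agree_on (2 * M) y z \<Longrightarrow> move z = move y"
  using step_local[of y 0 "move y" z] by (simp add: step_move agree_on_def)

lemma letter_local:
  assumes "agree_on M y z"
  shows "letter a0 z = letter a0 y"
proof -
  have N: "node z 0 l t \<longleftrightarrow> node y 0 l t" for l t
  proof -
    have "reads z (- int t) l \<longleftrightarrow> reads y (- int t) l" if "t < M"
    proof -
      have "z (- int t + int i) = y (- int t + int i)" if "i < M" for i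
        using assms that \<open>t < M\<close> unfolding agree_on_def by simp
      then show ?thesis unfolding reads_def by simp
    qed
    then show ?thesis using reads_length[of y "- int t" l] reads_length[of z "- int t" l]
      unfolding node_def by fastforce
  qed
  show ?thesis unfolding letter_def N ..
qed

text \<open>Injectivity and surjectivity of \<open>step\<close> on positions transfer to points
  because \<open>belt\<close> moves each point within its own shift orbit.\<close>

lemma belt_bij:
  "bij_betw belt (shift_space S) (shift_space S)"
  unfolding bij_betw_def
proof
  show "inj_on belt (shift_space S)"
  proof (rule inj_onI)
    fix x y assume eq: "belt x = belt y"
    \<comment> \<open>Points with equal images are shifts of each other by \<open>d\<close>; then
      the positions \<open>0\<close> and \<open>d\<close> of \<open>x\<close> step to the same
      position.\<close>
    define d where "d = move x - move y"
    have "y = shiftpow d x"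
    proof -
      have "y = shiftpow (- move y) (belt y)" by (simp add: belt_def shiftpow_add)
      also have "\<dots> = shiftpow (- move y) (belt x)" by (simp only: eq)
      also have "\<dots> = shiftpow d x" by (simp add: belt_def shiftpow_add d_def)
      finally show ?thesis .
    qed
    moreover have "step x 0 (move x)" by (simp add: step_move)
    moreover have "step x d (move x)" 
      unfolding step_iff_move calculation(1)[symmetric] by (simp add: d_def)
    ultimately have "d = 0" using step_injective by blast
    then show "x = y" using \<open>y = shiftpow d x\<close> by simp
  qed
  show "belt ` shift_space S = shift_space S"
  proof (intro equalityI subsetI)
    fix y assume y: "y \<in> shift_space S"
    obtain k where "step y k 0" using step_onto by blast
    then have "belt (shiftpow k y) = y" using belt_step by fastforce
    then show "y \<in> belt ` shift_space S" using y by (metis imageI shiftpow_in)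
  qed (auto simp: belt_def)
qed

end

section \<open>Embedding by simulated tapes\<close>

text \<open>The simulation is independent of belts: any element of the full group with a continuous
  letter-valued observation gives a homomorphism. Injectivity comes only from the hypothesis
  \<open>far\<close> of \<open>bounded_lookahead_image\<close>.\<close>

locale tape_reader =
  fixes S :: "'a set" and A :: "'b set" and \<tau> :: "(int \<Rightarrow> 'a) \<Rightarrow> (int \<Rightarrow> 'a)"
    and s :: "(int \<Rightarrow> 'a) \<Rightarrow> 'b"
  assumes S: "alphabet S" and A: "alphabet A" and \<tau>: "\<tau> \<in> carrier (TFG S)"
    and s_in: "\<And>y. s y \<in> A" and s_loc: "loc_const S s"
begin

interpretation TS: group "TFG S" by (rule group_TFG[OF S])
interpretation TA: group "TFG A" by (rule group_TFG[OF A])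

definition pw :: "int \<Rightarrow> (int \<Rightarrow> 'a) \<Rightarrow> (int \<Rightarrow> 'a)" where
  "pw i = \<tau> [^]\<^bsub>TFG S\<^esub> i"

lemma pw_carrier: "pw i \<in> carrier (TFG S)"
  unfolding pw_def using \<tau> by (rule TS.int_pow_closed)

lemma pw_in: "y \<in> shift_space S \<Longrightarrow> pw i y \<in> shift_space S"
  using TFG_continuous(1)[OF S pw_carrier] by blast

lemma pw_add: "y \<in> shift_space S \<Longrightarrow> pw (i + j) y = pw i (pw j y)"
  unfolding pw_def using TS.int_pow_mult[OF \<tau>, of i j] by (simp add: compose_eq)

lemma pw_0: "y \<in> shift_space S \<Longrightarrow> pw 0 y = y"
  by (simp add: pw_def)

lemma pw_1: "pw 1 = \<tau>"
  unfolding pw_def using TS.int_pow_1[OF \<tau>] .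

definition rd :: "(int \<Rightarrow> 'a) \<Rightarrow> (int \<Rightarrow> 'b)" where
  "rd y = (\<lambda>i. s (pw i y))"

lemma rd_in: "rd y \<in> shift_space A"
  by (simp add: rd_def shift_space_def s_in)

text \<open>\<open>rd\<close> intertwines \<open>\<tau>\<close> with the shift; this is the source
  of the homomorphism property of \<open>emb\<close>.\<close>

lemma rd_pw: "y \<in> shift_space S \<Longrightarrow> rd (pw j y) = shiftpow j (rd y)"
  by (simp add: rd_def shiftpow_def pw_add)

lemma rd_loc: "loc_const S (\<lambda>y. rd y i)"
  unfolding rd_def using TFG_continuous[OF S pw_carrier] s_loc
  by (intro continuous_loc_const[of "pw i" S S s]) simp_all

definition the_cocycle :: "((int \<Rightarrow> 'b) \<Rightarrow> (int \<Rightarrow> 'b)) \<Rightarrow> (int \<Rightarrow> 'b) \<Rightarrow> int" where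
  "the_cocycle g = (SOME c. is_cocycle A g c)"

lemma the_cocycle: 
  assumes "g \<in> carrier (TFG A)" 
  shows "is_cocycle A g (the_cocycle g)"
proof -
  have "\<exists>c. is_cocycle A g c" using assms by (simp add: TFG_mem[OF A])
  then show ?thesis unfolding the_cocycle_def by (rule someI_ex)
qed

text \<open>Iterating \<open>\<tau>\<close> sweeps a simulated tape \<open>rd y\<close> on which \<open>\<tau>\<close> acts as the shift,
  so every element of the full group over \<open>A\<close> can act on \<open>y\<close> through powers of \<open>\<tau>\<close>.\<close>
definition emb :: "((int \<Rightarrow> 'b) \<Rightarrow> (int \<Rightarrow> 'b)) \<Rightarrow> (int \<Rightarrow> 'a) \<Rightarrow> (int \<Rightarrow> 'a)" where
  "emb g = restrict (\<lambda>y. pw (the_cocycle g (rd y)) y) (shift_space S)"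

lemma emb_eq: "y \<in> shift_space S \<Longrightarrow> emb g y = pw (the_cocycle g (rd y)) y"
  by (simp add: emb_def)

lemma emb_in: "y \<in> shift_space S \<Longrightarrow> emb g y \<in> shift_space S"
  by (simp add: emb_eq pw_in)

lemma rd_emb: 
  assumes "g \<in> carrier (TFG A)" "y \<in> shift_space S"
  shows "rd (emb g y) = g (rd y)"
  using the_cocycle[OF assms(1)] assms(2) rd_in by (simp add: emb_eq rd_pw cocycle_alt)

text \<open>As \<open>f (rd y)\<close> is the tape of \<open>emb f y\<close>, the cocycle identity
  over \<open>A\<close> becomes additivity of exponents of \<open>\<tau>\<close>.\<close>

lemma emb_compose:
  assumes g: "g \<in> carrier (TFG A)" and f: "f \<in> carrier (TFG A)"
  shows "emb (compose (shift_space A) g f) = compose (shift_space S) (emb g) (emb f)"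
proof
  fix y
  show "emb (compose (shift_space A) g f) y = compose (shift_space S) (emb g) (emb f) y"
  proof (cases "y \<in> shift_space S")
    case y: True
    have gf: "compose (shift_space A) g f \<in> carrier (TFG A)"
      using TA.m_closed[OF g f] by simp
    have c: "the_cocycle (compose (shift_space A) g f) (rd y) = 
        the_cocycle g (f (rd y)) + the_cocycle f (rd y)"
      by (rule cocycle_unique[OF A the_cocycle[OF gf]
            cocycle_compose[OF A f the_cocycle[OF f] the_cocycle[OF g]] rd_in])
    have "emb g (emb f y) = pw (the_cocycle g (f (rd y))) (emb f y)"
      using y f by (simp add: emb_eq[OF emb_in] rd_emb)
    then show ?thesis using y by (simp add: emb_eq compose_eq c pw_add)
  qed (simp add: emb_def compose_def)
qed

lemma emb_one: "emb (restrict id (shift_space A)) = restrict id (shift_space S)"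
proof
  fix y
  have c: "the_cocycle (restrict id (shift_space A)) (rd y) = 0"
    using cocycle_unique[OF A the_cocycle cocycle_one rd_in] TA.one_closed by simp
  show "emb (restrict id (shift_space A)) y = restrict id (shift_space S) y"
    using c by (cases "y \<in> shift_space S") (simp_all add: emb_eq pw_0, simp add: emb_def)
qed

text \<open>The inverse is the embedded inverse, and the cocycle is that of the power of
  \<open>\<tau>\<close> selected by the tape.\<close>

lemma emb_carrier:
  assumes g: "g \<in> carrier (TFG A)"
  shows "emb g \<in> carrier (TFG S)"
proof -
  define g' where "g' = inv\<^bsub>TFG A\<^esub> g"
  have g': "g' \<in> carrier (TFG A)" unfolding g'_def using g by (rule TA.inv_closed)
  have 1: "compose (shift_space A) g g' = restrict id (shift_space A)"
    "compose (shift_space A) g' g = restrict id (shift_space A)"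
    using TA.r_inv[OF g] TA.l_inv[OF g] by (simp_all add: g'_def)
  have inv: "emb g (emb g' y) = y" "emb g' (emb g y) = y" if "y \<in> shift_space S" for y
  proof -
    have "compose (shift_space S) (emb g) (emb g') y = y" "compose (shift_space S) (emb g') (emb g) y = y"
      unfolding emb_compose[OF g g', symmetric] emb_compose[OF g' g, symmetric] 1 emb_one
      using that by simp_all
    then show "emb g (emb g' y) = y" "emb g' (emb g y) = y" using that by (simp_all add: compose_eq)
  qed
  have bij: "bij_betw (emb g) (shift_space S) (shift_space S)"
    by (rule bij_betw_byWitness[where f' = "emb g'"]) (use inv emb_in in auto)
  have "\<exists>c. is_cocycle S (pw i) c" for i using pw_carrier[of i] by (simp add: TFG_mem[OF S])
  then obtain d where d: "\<And>i. is_cocycle S (pw i) (d i)" by metis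
  have "loc_const S (\<lambda>y. the_cocycle g (rd y))"
    by (rule continuous_loc_const[of rd S A "the_cocycle g"])
      (use rd_in rd_loc the_cocycle[OF g] in \<open>auto simp: cocycle_alt\<close>)
  then have "loc_const S (\<lambda>y. d (the_cocycle g (rd y)) y)"
    by (rule loc_const_dep) (use d in \<open>simp add: cocycle_alt\<close>)
  then have "is_cocycle S (emb g) (\<lambda>y. d (the_cocycle g (rd y)) y)"
    using d by (simp add: cocycle_alt emb_eq)
  then show ?thesis using bij unfolding TFG_mem[OF S] by (auto simp: emb_def)
qed

lemma emb_hom: "emb \<in> hom (TFG A) (TFG S)"
  by (rule homI) (simp_all add: emb_carrier emb_compose)

text \<open>Reduces the task to finding, for each nontrivial \<open>g\<close>, a window whose radius
  exceeds the displacement by at most a constant. Since that displacement is nonzero, the same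
  witness shows that \<open>emb\<close> is injective on \<open>H\<close>.\<close>

lemma bounded_lookahead_image:
  assumes H: "subgroup H (TFG A)" 
    and far: "\<And>g. g \<in> H \<Longrightarrow> g \<noteq> \<one>\<^bsub>TFG A\<^esub> \<Longrightarrow> \<exists>n m x. 1 \<le> n \<and> m \<noteq> 0 \<and> n \<le> nat \<bar>m\<bar> + B \<and>
      x \<in> shift_space S \<and> (\<forall>y\<in>shift_space S. agree_on n x y \<longrightarrow> emb g y = shiftpow m y)"
  shows "in_class bounded_fun has_lookahead S ((TFG A)\<lparr>carrier := H\<rparr>)"
proof -
  interpret E: group_hom "TFG A" "TFG S" emb
    by unfold_locales (rule emb_hom)
  have HA: "g \<in> carrier (TFG A)" if "g \<in> H" for g using H that by (rule subgroup.mem_carrier)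
  \<comment> \<open>The look-ahead must vanish at \<open>0\<close>; the displacements
    \<open>m\<close> are nonzero, so they always see the value \<open>B\<close>.\<close>
  define \<alpha> where "\<alpha> = (\<lambda>k::nat. if k = 0 then 0 else B)"
  have agree: "agree_on n x y" if "y \<in> cylinder S (map x [- int n..int n]) (- int n)" for n x and y :: "int \<Rightarrow> 'a"
    unfolding agree_on_def
  proof (intro allI impI)
    fix i assume i: "\<bar>i\<bar> \<le> int n"
    define k where "k = nat (i + int n)"
    have k: "i = - int n + int k" "k < length (map x [- int n..int n])" using i by (simp_all add: k_def)
    have "y (- int n + int k) = map x [- int n..int n] ! k"
      using that k(2) unfolding cylinder_def by blast
    also have "\<dots> = x (- int n + int k)" using k(2) by simp
    finally show "x i = y i" using k(1) by simp
  qed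
  have one: "g = \<one>\<^bsub>TFG A\<^esub>" if g: "g \<in> H" and e: "emb g = \<one>\<^bsub>TFG S\<^esub>" for g
  proof (rule ccontr)
    assume "g \<noteq> \<one>\<^bsub>TFG A\<^esub>"
    then obtain n m x where *: "m \<noteq> 0" "x \<in> shift_space S" 
        "\<And>y. y \<in> shift_space S \<Longrightarrow> agree_on n x y \<Longrightarrow> emb g y = shiftpow m y"
      using far[OF g] by blast
    have "is_cocycle S (emb g) (\<lambda>_. 0)" using cocycle_one[of S] e by simp
    from cocycle_unique_local[OF S this *(3,2)] show False using * by simp
  qed
  have "inj_on emb H"
  proof (rule inj_onI)
    fix f g assume f: "f \<in> H" and g: "g \<in> H" and "emb f = emb g"
    then have "emb (f \<otimes>\<^bsub>TFG A\<^esub> inv\<^bsub>TFG A\<^esub> g) = \<one>\<^bsub>TFG S\<^esub>"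
      using E.hom_mult[OF HA TA.inv_closed[OF HA], of f g] E.hom_inv[OF HA, of g]
        TS.r_inv[OF emb_carrier[OF HA], of g] by metis
    then have "f \<otimes>\<^bsub>TFG A\<^esub> inv\<^bsub>TFG A\<^esub> g = \<one>\<^bsub>TFG A\<^esub>"
      using one f g H by (simp only: subgroup.m_closed subgroup.m_inv_closed)
    then show "f = g" using HA f g by (metis TA.inv_equality TA.inv_inv TA.inv_closed)
  qed
  then have "emb \<in> iso ((TFG A)\<lparr>carrier := H\<rparr>) ((TFG S)\<lparr>carrier := emb ` H\<rparr>)"
    using emb_hom HA by (auto simp: iso_def hom_def bij_betw_def)
  then have iso: "(TFG A)\<lparr>carrier := H\<rparr> \<cong> (TFG S)\<lparr>carrier := emb ` H\<rparr>"
    by (rule is_isoI)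
  have "has_lookahead S (emb ` H) \<alpha>"
    unfolding has_lookahead_def
  proof (intro conjI ballI impI allI)
    show "\<alpha> 0 = 0" by (simp add: \<alpha>_def)
    fix h c assume h: "h \<in> emb ` H" "h \<noteq> \<one>\<^bsub>TFG S\<^esub>" and c: "is_cocycle S h c"
    then obtain g where g: "g \<in> H" "h = emb g" by blast
    then have "g \<noteq> \<one>\<^bsub>TFG A\<^esub>" using h E.hom_one by metis
    then obtain n m x where *: "1 \<le> n" "m \<noteq> 0" "n \<le> nat \<bar>m\<bar> + B" "x \<in> shift_space S" 
        "\<And>y. y \<in> shift_space S \<Longrightarrow> agree_on n x y \<Longrightarrow> emb g y = shiftpow m y"
      using far[OF g(1)] by blast
    let ?w = "map x [- int n..int n]"
    have "length ?w = 2 * n + 1" "set ?w \<subseteq> S" using *(4) by (auto simp: shift_space_def)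
    moreover have "c y = m" if y: "y \<in> cylinder S ?w (- int n)" for y
    proof -
      have ag: "agree_on n x y" using agree[OF y] .
      show ?thesis
      proof (rule cocycle_unique_local[OF S c])
        show "y \<in> shift_space S" using y by (simp add: cylinder_def)
        fix z assume "z \<in> shift_space S" "agree_on n y z"
        then show "h z = shiftpow m z" using *(5) ag g(2) unfolding agree_on_def by simp
      qed
    qed
    moreover have "n \<le> nat \<bar>m\<bar> + \<alpha> (nat \<bar>m\<bar>)" using * by (simp add: \<alpha>_def)
    ultimately show "\<exists>n\<ge>1. \<exists>w. length w = 2 * n + 1 \<and> set w \<subseteq> S \<and> (\<exists>m. (\<forall>x\<in>cylinder S w (- int n). c x = m) 
        \<and> n \<le> nat \<bar>m\<bar> + \<alpha> (nat \<bar>m\<bar>))" using *(1) by blast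
  qed
  moreover have "bounded_fun \<alpha>" by (auto simp: bounded_fun_def \<alpha>_def)
  ultimately show ?thesis
    unfolding in_class_def using iso E.subgroup_img_is_subgroup[OF H] by blast
qed

end

section \<open>Realizing periodic points on belts\<close>

text \<open>Serves to distribute the letters of the left-moving lane over the \<open>L\<close> cells
  of a belt.\<close>

lemma split_into_chunks:
  assumes "L \<le> length v" "length v \<le> q * L"
  shows "\<exists>vs. length vs = L \<and> concat vs = v \<and> (\<forall>x\<in>set vs. 1 \<le> length x \<and> length x \<le> q)"
  using assms
proof (induction L arbitrary: v)
  case 0
  then show ?case by simp
next
  case (Suc L)
  \<comment> \<open>Greedy choice: as long as allowed while one letter is left for each of the
    \<open>L\<close> remaining chunks.\<close>
  define c where "c = min q (length v - L)"
  have q: "1 \<le> q" using Suc.prems by (cases q) auto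
  have c: "1 \<le> c" "c \<le> q" "c \<le> length v" using Suc.prems q by (auto simp: c_def)
  have "L \<le> q * L" using q by simp
  then have "L \<le> length (drop c v)" "length (drop c v) \<le> q * L" using Suc.prems by (auto simp: c_def min_def)
  from Suc.IH[OF this] obtain vs where vs: "length vs = L" "concat vs = drop c v"
      "\<forall>x\<in>set vs. 1 \<le> length x \<and> length x \<le> q" by blast
  show ?case by (rule exI[of _ "take c v # vs"]) (use vs c in auto)
qed

context belt_code
begin

text \<open>The letter at the final position is not read, so paths with matching ends concatenate
  without repeating a letter.\<close>

inductive path :: "'b \<Rightarrow> (int \<Rightarrow> 'a) \<Rightarrow> int \<Rightarrow> 'b list \<Rightarrow> int \<Rightarrow> bool" for a0 y where
  Nil: "path a0 y k [] k"
| Cons: "step y k k1 \<Longrightarrow> path a0 y k1 w k' \<Longrightarrow> path a0 y k (letter a0 (shiftpow k y) # w) k'"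

lemma path_append: "path a0 y k w k1 \<Longrightarrow> path a0 y k1 w' k2 \<Longrightarrow> path a0 y k (w @ w') k2"
  by (induction rule: path.induct) (auto intro: path.Cons)

lemma path_Cons_node:
  assumes "reads y k l" "t < length l" "step y (k + int t) k1" "path a0 y k1 w k'"
  shows "path a0 y (k + int t) (l ! t # w) k'"
  using path.Cons[OF assms(3,4)] letter_node[OF assms(1,2), of a0] by simp

text \<open>The exit \<open>e\<close> is left open, so one statement serves both for continuing to
  the left neighbour and for turning at the left end.\<close>

lemma path_tail:
  assumes r: "reads y k l" and e: "step y (k + int (length l) - 1) e"
  shows "1 \<le> t \<Longrightarrow> t < length l \<Longrightarrow> path a0 y (k + int t) (drop t l) e"
proof (induction "length l - t" arbitrary: t)
  case 0
  then show ?case by simp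
next
  case (Suc n)
  have d: "drop t l = l ! t # drop (Suc t) l" using Suc.prems by (simp add: Cons_nth_drop_Suc)
  show ?case
  proof (cases "Suc t = length l")
    case True
    then have "k + int (length l) - 1 = k + int t" by linarith
    then have "step y (k + int t) e" using e by (simp only:)
    then have "path a0 y (k + int t) [l ! t] e"
      by (rule path_Cons_node[OF r Suc.prems(2) _ path.Nil])
    then show ?thesis using True d by simp
  next
    case False
    then have "path a0 y (k + int (Suc t)) (drop (Suc t) l) e"
      using Suc.hyps(1)[of "Suc t"] Suc.hyps(2) Suc.prems False by simp
    moreover have "step y (k + int t) (k + int t + 1)"
      using inner[OF r Suc.prems(1)] False Suc.prems by simp
    ultimately show ?thesis unfolding d
      using path_Cons_node[OF r Suc.prems(2), of "k + int (Suc t)"] by (simp add: algebra_simps)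
  qed
qed

text \<open>Cells are numbered from the right end at the origin towards the left; the missing
  neighbours on both sides force the belt to turn there.\<close>

definition is_belt :: "(int \<Rightarrow> 'a) \<Rightarrow> 'b list list \<Rightarrow> bool" where
  "is_belt y ls \<longleftrightarrow> ls \<noteq> [] \<and> (\<forall>j<length ls. reads y (- (int M * int j)) (ls ! j)) \<and>
     (\<forall>l. \<not> reads y (int M) l) \<and> (\<forall>l. \<not> reads y (- (int M * int (length ls))) l)"

text \<open>Induction on the distance from the right end, where the belt turns from the head of cell
  \<open>0\<close> to position \<open>1\<close>, the first left-lane node.\<close>

lemma path_right_lane:
  assumes b: "is_belt y ls"
  shows "j < length ls \<Longrightarrow> path a0 y (- (int M * int j)) (map hd (rev (take (Suc j) ls))) 1"
proof (induction j)
  case 0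
  then have r: "reads y 0 (ls ! 0)" using b unfolding is_belt_def by force
  then have "step y 0 1" using turn_right[OF r] b unfolding is_belt_def by simp
  moreover have "ls ! 0 \<noteq> []" using reads_length[OF r] by auto
  ultimately have "path a0 y 0 [ls ! 0 ! 0] 1"
    using path_Cons_node[OF r, of 0 1 a0 "[]" 1] path.Nil by simp
  then show ?case using 0 \<open>ls ! 0 \<noteq> []\<close> by (simp add: hd_conv_nth take_Suc_conv_app_nth)
next
  case (Suc j)
  let ?k = "- (int M * int (Suc j))"
  have r: "reads y ?k (ls ! Suc j)" using b Suc.prems unfolding is_belt_def by blast
  have r': "reads y (- (int M * int j)) (ls ! j)" using b Suc.prems unfolding is_belt_def by force
  have k: "?k + int M = - (int M * int j)" by (simp add: algebra_simps)
  have "step y ?k (?k + int M)" using r r' k by (intro right[of y ?k _ "ls ! j"]) simp_all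
  then have s: "step y (?k + int 0) (- (int M * int j))" using k by simp
  have ne: "ls ! Suc j \<noteq> []" using reads_length[OF r] by auto
  have "path a0 y (?k + int 0) (ls ! Suc j ! 0 # map hd (rev (take (Suc j) ls))) 1"
    by (rule path_Cons_node[OF r _ s]) (use Suc ne in auto)
  then show ?case using Suc.prems ne by (simp add: hd_conv_nth take_Suc_conv_app_nth[of "Suc j"])
qed

text \<open>Traverses the cells in list order and turns at the left end to the head of the last
  cell, where \<open>path_right_lane\<close> can start again.\<close>

lemma path_left_lane:
  assumes b: "is_belt y ls"
  shows "j < length ls \<Longrightarrow> path a0 y (- (int M * int j) + 1) (concat (map tl (drop j ls)))
    (- (int M * int (length ls - 1)))"
proof (induction "length ls - j" arbitrary: j)
  case 0
  then show ?case by simp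
next
  case (Suc n)
  let ?k = "- (int M * int j)"
  have r: "reads y ?k (ls ! j)" using b Suc.prems unfolding is_belt_def by blast
  have len: "2 \<le> length (ls ! j)" using reads_length[OF r] by simp
  have d: "drop j ls = ls ! j # drop (Suc j) ls" using Suc.prems by (simp add: Cons_nth_drop_Suc)
  have k: "?k - int M = - (int M * int (Suc j))" by (simp add: algebra_simps)
  show ?case
  proof (cases "Suc j = length ls")
    case True
    then have "\<forall>l'. \<not> reads y (?k - int M) l'" using b k unfolding is_belt_def by simp
    then have "step y (?k + int (length (ls ! j)) - 1) ?k" using turn_left[OF r] by blast
    from path_tail[OF r this, of 1 a0] have "path a0 y (?k + 1) (tl (ls ! j)) ?k"
      using len by (simp add: drop_Suc)
    moreover have "length ls - 1 = j" "drop (Suc j) ls = []" using True by auto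
    ultimately show ?thesis unfolding d by simp
  next
    case False
    then have j: "Suc j < length ls" using Suc.prems by simp
    then have "reads y (?k - int M) (ls ! Suc j)" unfolding k using b unfolding is_belt_def by blast
    then have "step y (?k + int (length (ls ! j)) - 1) (?k - int M + 1)" by (rule left[OF r])
    from path_tail[OF r this, of 1 a0] have p: "path a0 y (?k + 1) (tl (ls ! j)) (?k - int M + 1)"
      using len by (simp add: drop_Suc)
    have "path a0 y (?k - int M + 1) (concat (map tl (drop (Suc j) ls)))
        (- (int M * int (length ls - 1)))"
      unfolding k using Suc.hyps(1)[OF _ j] Suc.hyps(2) by simp
    from path_append[OF p this] show ?thesis unfolding d by simp
  qed
qed

end

text \<open>The letter \<open>b\<close> serves as blank: no codeword begins with it, so a
  \<open>b\<close> at the position where a neighbour would start ends a belt.\<close>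

locale belt_system = belt_code A K M code
  for A :: "'b set" and K M :: nat and code :: "'b list \<Rightarrow> 'a list" +
  fixes S :: "'a set" and b :: 'a and a0 :: 'b
  assumes S: "alphabet S" and A: "alphabet A" and a0: "a0 \<in> A" and b: "b \<in> S" and M: "1 \<le> M"
    and code: "\<And>l. l \<in> cells A K \<Longrightarrow> length (code l) = M \<and> set (code l) \<subseteq> S \<and> code l ! 0 \<noteq> b"
begin

section \<open>Belt motion as a tape reader\<close>

definition belt_map :: "(int \<Rightarrow> 'a) \<Rightarrow> (int \<Rightarrow> 'a)" where
  "belt_map = restrict belt (shift_space S)"

lemma belt_TFG: "belt_map \<in> carrier (TFG S)"
proof -
  have "loc_const S move" unfolding loc_const_def using move_local by blast
  then have "is_cocycle S belt_map move" by (simp add: belt_map_def cocycle_alt belt_def)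
  then show ?thesis using belt_bij[of S] unfolding TFG_mem[OF S] belt_map_def
    by (auto cong: bij_betw_cong)
qed

sublocale tape_reader S A belt_map "letter a0"
proof
  show "loc_const S (letter a0)" unfolding loc_const_def using letter_local by blast
qed (use S A belt_TFG letter_in[OF a0] in auto)

text \<open>Translates positions visited along a belt into iterates of \<open>belt_map\<close> and
  letters of the simulated tape.\<close>

lemma path_pw:
  assumes "path a0 y k w k'" and y: "y \<in> shift_space S"
  shows "pw (int (length w)) (shiftpow k y) = shiftpow k' y \<and>
    (\<forall>i<length w. letter a0 (pw (int i) (shiftpow k y)) = w ! i)"
  using assms(1)
proof induction
  case (Nil k)
  then show ?case using y by (simp add: pw_0)
next
  case (Cons k k1 w k')
  have 1: "pw 1 (shiftpow k y) = shiftpow k1 y"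
    unfolding pw_1 using belt_step[OF Cons.hyps(1)] y by (simp add: belt_map_def)
  have 2: "pw (int i + 1) (shiftpow k y) = pw (int i) (shiftpow k1 y)" for i
    using y by (simp add: pw_add 1)
  have "letter a0 (pw (int i) (shiftpow k y)) = (letter a0 (shiftpow k y) # w) ! i"
    if "i < Suc (length w)" for i
  proof (cases i)
    case 0
    then show ?thesis using y by (simp add: pw_0)
  next
    case (Suc i')
    then show ?thesis using Cons.IH that 2[of i'] by (simp add: add.commute)
  qed
  then show ?case using Cons.IH 2[of "length w"] by (simp add: add.commute)
qed

lemma pw_fixed_mult:
  assumes x: "x \<in> shift_space S" and fp: "pw p x = x"
  shows "pw (p * j) x = x"
proof (induction j rule: int_induct[where k = 0])
  case base
  then show ?case using x by (simp add: pw_0)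
next
  case (step1 i)
  have "p * (i + 1) = p * i + p" by (simp add: algebra_simps)
  then show ?case using step1 pw_add[OF x, of "p * i" p] by (simp only: fp)
next
  case (step2 i)
  have "p * i = p * (i - 1) + p" by (simp add: algebra_simps)
  then have e: "pw (p * i) x = pw (p * (i - 1)) x" using pw_add[OF x, of "p * (i - 1)" p] by (simp only: fp)
  show ?case by (rule trans[OF e[symmetric] step2(2)])
qed

lemma shiftpow_fixed_mult:
  assumes "shiftpow p u = u"
  shows "u (i + p * j) = u i"
proof -
  have p: "u (i + p) = u i" for i using assms unfolding shiftpow_def by metis
  show ?thesis
  proof (induction j rule: int_induct[where k = 0])
    case (step1 j)
    then show ?case using p[of "i + p * j"] by (simp add: algebra_simps)
  next
    case (step2 j)
    then show ?case using p[of "i + p * (j - 1)"] by (simp add: algebra_simps)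
  qed simp
qed

text \<open>A cyclic word of length \<open>P\<close> is wrapped around a belt of \<open>L\<close>
  cells: its first \<open>L\<close> letters fill the right-moving lane, the others the left-moving
  lane. The bounds on \<open>P\<close> allow between \<open>1\<close> and \<open>K - 1\<close>
  left-lane letters in every cell. The window includes the two blanks that delimit the belt.\<close>

lemma realize_periodic:
  assumes u: "u \<in> shift_space A" and per: "shiftpow (int P) u = u"
    and L: "1 \<le> L" and P: "2 * L \<le> P" "P \<le> K * L"
  obtains y0 where "y0 \<in> shift_space S"
    "\<And>z. z \<in> shift_space S \<Longrightarrow> (\<And>i. - (int M * int L) \<le> i \<Longrightarrow> i \<le> int M \<Longrightarrow> z i = y0 i) \<Longrightarrow>
       rd (shiftpow (- (int M * int (L - 1))) z) = u \<and>
       pw (int L) (shiftpow (- (int M * int (L - 1))) z) = shiftpow 1 z"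
proof -
  define U where "U = map (\<lambda>i. u (int i)) [0..<P]"
  have UA: "set U \<subseteq> A" using u by (auto simp: U_def shift_space_def)
  have lU: "length U = P" by (simp add: U_def)
  have "\<exists>vs. length vs = L \<and> concat vs = drop L U \<and> (\<forall>x\<in>set vs. 1 \<le> length x \<and> length x \<le> K - 1)"
    by (rule split_into_chunks) (use P lU in \<open>auto simp: algebra_simps diff_mult_distrib\<close>)
  then obtain vs where vs: "length vs = L" "concat vs = drop L U"
    "\<And>x. x \<in> set vs \<Longrightarrow> 1 \<le> length x \<and> length x \<le> K - 1" by blast
  \<comment> \<open>Reversed because cells are numbered from the right while the right-moving lane
    is read from the left.\<close>
  define ls where "ls = map2 (#) (rev (take L U)) vs"
  have lt: "length (take L U) = L" using lU P by simp
  have lls: "length ls = L" using lt vs by (simp add: ls_def)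
  have hds: "map hd (rev ls) = take L U"
    using lt vs by (simp add: ls_def rev_map[symmetric] comp_def case_prod_beta)
  have tls: "map tl ls = vs"
    using lt vs by (simp add: ls_def comp_def case_prod_beta)
  have cells: "l \<in> cells A K" if "l \<in> set ls" for l
  proof -
    obtain a v where av: "l = a # v" "(a, v) \<in> set (zip (rev (take L U)) vs)"
      using \<open>l \<in> set ls\<close> unfolding ls_def by auto
    have l: "l = a # v" "a \<in> set (take L U)" "v \<in> set vs"
      using av set_zip_leftD[OF av(2)] set_zip_rightD[OF av(2)] by simp_all
    have "set v \<subseteq> set (concat vs)" using l(3) by auto
    also have "\<dots> \<subseteq> set U" unfolding vs(2) by (rule set_drop_subset)
    finally have "set l \<subseteq> A" using l UA set_take_subset[of L U] by auto
    then show ?thesis using vs(3)[OF l(3)] l(1) by (auto simp: cells_def)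
  qed
  \<comment> \<open>Block \<open>- j\<close> of length \<open>M\<close> carries the codeword of cell
    \<open>j\<close>; all other blocks are blank.\<close>
  define y0 where "y0 = (\<lambda>i. let j = - (i div int M) in
      if 0 \<le> j \<and> j < int L then code (ls ! nat j) ! nat (i mod int M) else b)"
  have y0: "y0 \<in> shift_space S"
    unfolding shift_space_def
  proof (intro CollectI allI)
    fix i
    show "y0 i \<in> S"
    proof (cases "0 \<le> - (i div int M) \<and> - (i div int M) < int L")
      case True
      then have "nat (- (i div int M)) < length ls" unfolding lls by (subst nat_less_iff) auto
      then have c: "ls ! nat (- (i div int M)) \<in> cells A K" using cells by simp
      have "nat (i mod int M) < M" using M by (simp add: nat_less_iff)
      then have "code (ls ! nat (- (i div int M))) ! nat (i mod int M) \<in> S"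
        using code[OF c] by (metis nth_mem subsetD)
      then show ?thesis using True by (simp add: y0_def Let_def)
    next
      case False
      then show ?thesis using b by (auto simp: y0_def Let_def)
    qed
  qed
  have "rd (shiftpow (- (int M * int (L - 1))) z) = u \<and>
       pw (int L) (shiftpow (- (int M * int (L - 1))) z) = shiftpow 1 z"
    if z: "z \<in> shift_space S" and eq: "\<And>i. - (int M * int L) \<le> i \<Longrightarrow> i \<le> int M \<Longrightarrow> z i = y0 i" for z
  proof -
    let ?k = "- (int M * int (L - 1))"
    have nonneg: "0 \<le> int M * int L" "0 \<le> int M" by simp_all
    have blank: "\<not> reads z k l" if "z k = b" for k l
      using that code[of l] M unfolding reads_def by (metis add.right_neutral of_nat_0 less_one not_less order_less_le_trans)
    have "reads z (- (int M * int j)) (ls ! j)" if j: "j < L" for j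
      unfolding reads_def
    proof (intro conjI allI impI)
      show "ls ! j \<in> cells A K" using cells j lls by simp
      fix i assume i: "i < M"
      let ?i = "- (int M * int j) + int i"
      have dm: "?i div int M = - int j" "?i mod int M = int i"
        using i int_div_pos_eq[of ?i "int M" "- int j" "int i"] int_mod_pos_eq[of ?i "int M" "- int j" "int i"]
        by simp_all
      have "int M * int j \<le> int M * int L" using j by (intro mult_left_mono) auto
      moreover have "0 \<le> int M * int j" by simp
      ultimately have "z ?i = y0 ?i" using i by (intro eq) linarith+
      also have "\<dots> = code (ls ! j) ! i" using j unfolding y0_def dm by simp
      finally show "z ?i = code (ls ! j) ! i" .
    qed
    moreover have "z (int M) = b"
    proof -
      have "z (int M) = y0 (int M)" by (rule eq) (use nonneg in linarith)+
      then show ?thesis using M by (simp add: y0_def)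
    qed
    moreover have "z (- (int M * int L)) = b"
    proof -
      have "z (- (int M * int L)) = y0 (- (int M * int L))"
        by (rule eq) (use nonneg in linarith)+
      moreover have "- (int M * int L) div int M = - int L"
        using M by (metis mult_minus_right nonzero_mult_div_cancel_left of_nat_eq_0_iff not_one_le_zero)
      ultimately show ?thesis by (simp add: y0_def)
    qed
    ultimately have belt: "is_belt z ls"
      unfolding is_belt_def lls using blank L lls by auto
    \<comment> \<open>These \<open>L\<close> steps lead from the left end to position
      \<open>1\<close> at the right end, as claimed for \<open>pw (int L)\<close>.\<close>
    have p1: "path a0 z ?k (take L U) 1"
      using path_right_lane[OF belt, of "L - 1" a0] L lls by (simp add: hds)
    have p2: "path a0 z 1 (drop L U) ?k"
      using path_left_lane[OF belt, of 0 a0] L lls by (simp add: tls vs)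
    \<comment> \<open>Closing the loop makes the tape \<open>P\<close>-periodic, so agreement with
      \<open>u\<close> on one period suffices.\<close>
    have p: "path a0 z ?k U ?k" using path_append[OF p1 p2] by simp
    let ?x = "shiftpow ?k z"
    have x: "?x \<in> shift_space S" using z by simp
    have fixP: "pw (int P) ?x = ?x" using path_pw[OF p z] lU by simp
    have "rd ?x i = u i" for i
    proof -
      define r where "r = nat (i mod int P)"
      have P0: "0 < P" using L P by linarith
      have r: "int r = i mod int P" "r < P" using P0 by (auto simp: r_def nat_less_iff)
      have i: "i = int r + int P * (i div int P)" using r by simp
      have "pw i ?x = pw (int r) (pw (int P * (i div int P)) ?x)" 
        using pw_add[OF x, of "int r"] i by metis
      also have "\<dots> = pw (int r) ?x" using pw_fixed_mult[OF x fixP] by simp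
      finally have "rd ?x i = letter a0 (pw (int r) ?x)" by (simp add: rd_def)
      also have "\<dots> = U ! r" using path_pw[OF p z] r lU by blast
      also have "\<dots> = u (int r)" using r by (simp add: U_def)
      also have "\<dots> = u i" using shiftpow_fixed_mult[OF per, of "int r"] i by metis
      finally show ?thesis .
    qed
    then show ?thesis using path_pw[OF p1 z] lt by auto
  qed
  then show ?thesis using that y0 by blast
qed

text \<open>The value \<open>c x\<close> prescribes the number of cells, so that \<open>g\<close>
  crosses exactly the right-moving lane, from one end of the belt to the other. The hypothesis on
  \<open>K\<close> leaves room for a multiple of the period \<open>p\<close> on such a belt.\<close>

lemma far_move:
  assumes g: "g \<in> carrier (TFG A)" and c: "is_cocycle A g c" 
    and x: "x \<in> shift_space A" and p: "1 \<le> p" "shiftpow (int p) x = x" 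
    and c0: "c x \<noteq> 0" and K: "p + 2 * nat \<bar>c x\<bar> \<le> K * nat \<bar>c x\<bar>"
  shows "\<exists>n m x. 1 \<le> n \<and> m \<noteq> 0 \<and> n \<le> nat \<bar>m\<bar> + 2 * M \<and>
      x \<in> shift_space S \<and> (\<forall>y\<in>shift_space S. agree_on n x y \<longrightarrow> emb g y = shiftpow m y)"
proof -
  define L where "L = nat \<bar>c x\<bar>"
  \<comment> \<open>The period may be smaller than \<open>L\<close>, but a belt of \<open>L\<close> cells has at least \<open>2 * L\<close> nodes.\<close>
  define P where "P = p * (2 * L div p + 1)"
  define k where "k = - (int M * int (L - 1))"
  \<comment> \<open>Large enough to show the belt with both blanks from either end, yet only
    \<open>2 * M - 1\<close> more than the distance \<open>M * (L - 1) + 1\<close> between the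
    ends.\<close>
  define n where "n = M * (L + 1)"
  have L: "1 \<le> L" using c0 by (simp add: L_def)
  have P: "2 * L \<le> P" "P \<le> 2 * L + p"
    using p(1) dividend_less_times_div[of p "2 * L"] times_div_less_eq_dividend[of p "2 * L"]
    by (simp_all add: P_def)
  have K: "P \<le> K * L" using P(2) K by (simp add: L_def)
  have n: "int n = int M * int (L - 1) + 2 * int M" 
    using L by (simp add: n_def of_nat_diff algebra_simps)
  have n1: "1 \<le> n" using M by (simp add: n_def)
  have MLe: "int M * int L = int M * int (L - 1) + int M" using L by (simp add: of_nat_diff algebra_simps)
  have M0: "0 \<le> int M * int (L - 1)" "1 \<le> int M" using M by simp_all
  have cc: "the_cocycle g x = c x" using cocycle_unique[OF A the_cocycle[OF g] c x] .
  \<comment> \<open>For negative \<open>c x\<close> the point starts at the right end,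
    \<open>L\<close> steps after the left end, so the tape at the left end has to be
    \<open>x\<close> shifted back by \<open>L\<close>.\<close>
  define u where "u = shiftpow (if c x > 0 then 0 else - int L) x"
  have u: "u \<in> shift_space A" using x by (simp add: u_def)
  have "shiftpow (int P) x = x"
  proof
    fix i
    show "shiftpow (int P) x i = x i"
      unfolding shiftpow_def P_def of_nat_mult by (rule shiftpow_fixed_mult[OF p(2)])
  qed
  then have per: "shiftpow (int P) u = u"
    unfolding u_def shiftpow_add by (metis shiftpow_add add.commute)
  obtain y0 where y0: "y0 \<in> shift_space S" and
    R: "\<And>z. z \<in> shift_space S \<Longrightarrow> (\<And>i. - (int M * int L) \<le> i \<Longrightarrow> i \<le> int M \<Longrightarrow> z i = y0 i) \<Longrightarrow>
       rd (shiftpow k z) = u \<and> pw (int L) (shiftpow k z) = shiftpow 1 z"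
    using realize_periodic[OF u per L P(1) K] unfolding k_def by blast
  \<comment> \<open>\<open>e\<close> is the starting end and \<open>m\<close> the displacement to
    the opposite one.\<close>
  define e where "e = (if c x > 0 then k else 1)"
  define m where "m = (if c x > 0 then 1 - k else k - 1)"
  have "emb g y = shiftpow m y" if y: "y \<in> shift_space S" and ag: "agree_on n (shiftpow e y0) y" for y
  proof -
    define z where "z = shiftpow (- e) y"
    have z: "z \<in> shift_space S" using y by (simp add: z_def)
    have ye: "y = shiftpow e z" by (simp add: z_def shiftpow_add)
    have zy: "z i = y0 i" if i: "- (int M * int L) \<le> i" "i \<le> int M" for i
    proof -
      have "\<bar>i - k\<bar> \<le> int n" "\<bar>i - 1\<bar> \<le> int n" 
        unfolding n k_def using i M0 MLe by linarith+
      then have "\<bar>i - e\<bar> \<le> int n" by (cases "c x > 0") (simp_all only: e_def if_True if_False)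
      then show ?thesis using ag unfolding agree_on_def z_def shiftpow_def by fastforce
    qed
    have R1: "rd (shiftpow k z) = u" "pw (int L) (shiftpow k z) = shiftpow 1 z" using R[OF z zy] by blast+
    show ?thesis
    proof (cases "c x > 0")
      case True
      then have "rd y = x" using R1 ye by (simp add: e_def u_def)
      then have "emb g y = pw (int L) y" using True y cc by (simp add: emb_eq L_def)
      also have "\<dots> = shiftpow 1 z" using True R1 ye by (simp add: e_def)
      also have "\<dots> = shiftpow m y" using True by (simp add: ye m_def e_def shiftpow_add)
      finally show ?thesis .
    next
      case False
      have ypw: "y = pw (int L) (shiftpow k z)" using R1 ye False by (simp add: e_def)
      have "rd y = shiftpow (int L) u" unfolding ypw R1(1)[symmetric] using z by (intro rd_pw) simp
      then have "rd y = x" using False by (simp add: u_def shiftpow_add)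
      then have "emb g y = pw (- int L) y" using False y cc by (simp add: emb_eq L_def)
      also have "\<dots> = pw (- int L + int L) (shiftpow k z)" unfolding ypw using z by (simp only: pw_add shiftpow_in)
      also have "\<dots> = shiftpow k z" using z by (simp add: pw_0)
      also have "\<dots> = shiftpow m y" using False by (simp add: ye m_def e_def shiftpow_add)
      finally show ?thesis .
    qed
  qed
  moreover have k0: "k \<le> 0" unfolding k_def using M0 by linarith
  then have am: "\<bar>m\<bar> = 1 - k" by (simp add: m_def)
  have "m \<noteq> 0" using am k0 by linarith
  moreover have "int n \<le> 1 - k + 2 * int M" unfolding n k_def by linarith
  then have "n \<le> nat \<bar>m\<bar> + 2 * M" unfolding am using k0 by linarith
  ultimately show ?thesis using n1 y0 by (meson shiftpow_in)
qed

end

text \<open>Self-synchronizing codewords: a marker of repeated \<open>a\<close>, then an injective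
  name of the cell contents between two letters \<open>b\<close>.\<close>

lemma exists_code:
  fixes S :: "'a set" and A :: "'b set" and K :: nat
  assumes S: "alphabet S" and A: "alphabet A"
  obtains M code b a0 where "belt_system A K M (code :: 'b list \<Rightarrow> 'a list) S b a0"
proof -
  have "\<exists>a\<in>S. \<exists>b\<in>S. a \<noteq> b"
    using S unfolding alphabet_def by (metis card_le_Suc0_iff_eq not_less_eq_eq numeral_2_eq_2)
  then obtain a b where ab: "a \<in> S" "b \<in> S" "a \<noteq> b" by blast
  obtain a0 where a0: "a0 \<in> A" using A by (force simp: alphabet_def)
  have fin: "finite (cells A K)"
    by (rule finite_subset[OF _ finite_lists_length_le[of A K]]) (use A in \<open>auto simp: cells_def alphabet_def\<close>)
  \<comment> \<open>The first summand provides enough words of length \<open>N\<close> over at least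
    two letters to name all cells, the second ensures \<open>K \<le> M\<close>.\<close>
  define N where "N = card (cells A K) + K"
  let ?W = "{w. set w \<subseteq> S \<and> length w = N}"
  have finS: "finite S" using S by (simp add: alphabet_def)
  have "card (cells A K) \<le> 2 ^ N" unfolding N_def
    by (meson le_add1 less_exp less_imp_le order_trans)
  also have "\<dots> \<le> card S ^ N" using S by (intro power_mono) (auto simp: alphabet_def)
  also have "\<dots> = card ?W" using card_lists_length_eq[OF finS] by simp
  finally have "card (cells A K) \<le> card ?W" .
  then obtain f where f: "f ` cells A K \<subseteq> ?W" "inj_on f (cells A K)"
    using card_le_inj[OF fin finite_lists_length_eq[OF finS]] by blast
  \<comment> \<open>A run of \<open>N + 1\<close> letters \<open>a\<close> occurs only at the start of such a word, so occurrences cannot overlap.\<close>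
  define code where "code = (\<lambda>l. replicate (N + 1) a @ [b] @ f l @ [b])"
  define M where "M = 2 * N + 3"
  have lf: "length (f l) = N" "set (f l) \<subseteq> S" if "l \<in> cells A K" for l using f(1) that by auto
  have len: "length (code l) = M" if "l \<in> cells A K" for l
    using lf[OF that] by (simp add: code_def M_def)
  have ca: "code l ! i = a" if "i < N + 1" for l i
    using that unfolding code_def by (subst nth_append) (simp del: replicate_Suc)
  have cb1: "code l ! (N + 1) = b" for l 
    unfolding code_def by (subst nth_append) (simp del: replicate_Suc)
  have cb2: "code l ! (2 * N + 2) = b" if "l \<in> cells A K" for l
    using lf[OF that] unfolding code_def by (simp del: replicate_Suc add: nth_append)
  have ordered: "k = k' \<and> l = l'" if l: "l \<in> cells A K" "l' \<in> cells A K" and d: "k \<le> k'" "k' - k < int M"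
    and y: "\<And>i. i < M \<Longrightarrow> y (k + int i) = code l ! i" "\<And>i. i < M \<Longrightarrow> y (k' + int i) = code l' ! i"
    for y :: "int \<Rightarrow> 'a" and k k' l l'
  proof -
    define e where "e = nat (k' - k)"
    have k': "k' = k + int e" "e < M" using d by (auto simp: e_def)
    have eq: "code l ! (e + i) = code l' ! i" if "e + i < M" for i
      using y(1)[of "e + i"] y(2)[of i] that by (simp add: k' algebra_simps)
    consider "e = 0" | "1 \<le> e" "e \<le> N + 1" | "N + 2 \<le> e" by linarith
    then show ?thesis
    proof cases
      case 1
      have "code l = code l'" using eq 1 len l by (intro nth_equalityI) auto
      then have "f l = f l'" by (simp add: code_def)
      then show ?thesis using f(2) l 1 k' by (simp add: inj_on_eq_iff)
    next
      case 2
      \<comment> \<open>The separator \<open>b\<close> of the first word falls into the run of the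
        second.\<close>
      then have "b = a" using eq[of "N + 1 - e"] cb1[of l] ca[of "N + 1 - e" l'] by (simp add: M_def)
      then show ?thesis using ab by simp
    next
      case 3
      \<comment> \<open>Here the second word starts after that separator, and the final
        \<open>b\<close> of the first word falls into the run instead.\<close>
      then have "b = a" using eq[of "2 * N + 2 - e"] cb2[OF l(1)] ca[of "2 * N + 2 - e" l'] k'(2)
        by (simp add: M_def)
      then show ?thesis using ab by simp
    qed
  qed
  have "belt_system A K M code S b a0"
  proof
    show "K \<le> M" by (simp add: M_def N_def)
    show "k = k' \<and> l = l'" if "l \<in> cells A K" "l' \<in> cells A K" "\<bar>k - k'\<bar> < int M"
      "\<And>i. i < M \<Longrightarrow> y (k + int i) = code l ! i" "\<And>i. i < M \<Longrightarrow> y (k' + int i) = code l' ! i"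
      for y k k' l l'
      using ordered[of l l' k k' y] ordered[of l' l k' k y] that by (cases "k \<le> k'") auto
    show "length (code l) = M \<and> set (code l) \<subseteq> S \<and> code l ! 0 \<noteq> b" if "l \<in> cells A K" for l
      using len[OF that] lf[OF that] ab ca[of 0 l] by (auto simp: code_def)
  qed (use S A a0 ab in \<open>simp_all add: M_def\<close>)
  then show ?thesis using that by blast
qed

text \<open>The one inclusion that changes the alphabet and strengthens the look-ahead; taking
  \<open>A\<close> and \<open>S\<close> independently also settles the unions over all
  alphabets.\<close>

lemma plin_imp_bnd:
  fixes A :: "'b set" and S :: "'a set"
  assumes A: "alphabet A" and S: "alphabet S" and plin: "G_plin A G"
  shows "G_bnd S G"
proof -
  obtain H \<alpha> C where H: "subgroup H (TFG A)" and \<alpha>: "\<And>n. \<alpha> n \<le> C * n + C"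
    and la: "has_plookahead A H \<alpha>" and GH: "G \<cong> (TFG A)\<lparr>carrier := H\<rparr>"
    using plin unfolding G_plin_def in_class_def linear_fun_def by blast
  \<comment> \<open>With \<open>L = nat \<bar>c x\<bar> \<ge> 1\<close> one has
    \<open>p \<le> 2 * n + 1 \<le> 2 * (L + C * L + C) + 1\<close>, so
    \<open>p + 2 * L \<le> (4 * C + 5) * L\<close>.\<close>
  define K where "K = 4 * C + 5"
  obtain M code b a0 where "belt_system A K M (code :: 'b list \<Rightarrow> 'a list) S b a0"
    using exists_code[OF S A] .
  then interpret B: belt_system A K M code S b a0 .
  have "in_class bounded_fun has_lookahead S ((TFG A)\<lparr>carrier := H\<rparr>)"
  proof (rule B.bounded_lookahead_image[OF H, where B = "2 * M"])
    fix g assume g: "g \<in> H" "g \<noteq> \<one>\<^bsub>TFG A\<^esub>"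
    have gc: "g \<in> carrier (TFG A)" using H g(1) by (rule subgroup.mem_carrier)
    then have "\<exists>c. is_cocycle A g c" by (simp add: TFG_mem[OF A])
    then obtain c where c: "is_cocycle A g c" ..
    then obtain n x p where n: "1 \<le> n" and x: "x \<in> shift_space A"
      and p: "1 \<le> p" "p \<le> 2 * n + 1" "shiftpow (int p) x = x"
      and le: "n \<le> nat \<bar>c x\<bar> + \<alpha> (nat \<bar>c x\<bar>)"
      using la g unfolding has_plookahead_def by blast
    have "\<alpha> 0 = 0" using la by (simp add: has_plookahead_def)
    \<comment> \<open>The normalization of \<open>\<alpha>\<close> at \<open>0\<close> is decisive:
      with \<open>c x = 0\<close> the bound would force \<open>n = 0\<close>.\<close>
    then have c0: "c x \<noteq> 0" using n le by auto
    then have L: "1 \<le> nat \<bar>c x\<bar>" by simp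
    have "C * 1 \<le> C * nat \<bar>c x\<bar>" using L by (rule mult_le_mono2)
    moreover have "K * nat \<bar>c x\<bar> = 4 * (C * nat \<bar>c x\<bar>) + 5 * nat \<bar>c x\<bar>"
      by (simp add: K_def algebra_simps)
    ultimately have "p + 2 * nat \<bar>c x\<bar> \<le> K * nat \<bar>c x\<bar>"
      using p(2) le \<alpha>[of "nat \<bar>c x\<bar>"] L by linarith
    then show "\<exists>n m x. 1 \<le> n \<and> m \<noteq> 0 \<and> n \<le> nat \<bar>m\<bar> + 2 * M \<and> x \<in> shift_space S \<and>
        (\<forall>y\<in>shift_space S. agree_on n x y \<longrightarrow> B.emb g y = shiftpow m y)"
      by (rule B.far_move[OF gc c x p(1,3) c0])
  qed
  then show ?thesis
    unfolding G_bnd_def in_class_def using iso_trans[OF GH] by blast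
qed

section \<open>Comparison of the classes\<close>

lemma lookahead_imp_plookahead:
  assumes la: "has_lookahead S H \<alpha>"
  shows "has_plookahead S H \<alpha>"
  unfolding has_plookahead_def
proof (intro conjI ballI impI allI)
  show "\<alpha> 0 = 0" using la by (simp add: has_lookahead_def)
  fix g c assume "g \<in> H" "g \<noteq> \<one>\<^bsub>TFG S\<^esub>" "is_cocycle S g c"
  then obtain n w m where n: "1 \<le> n" and w: "length w = 2 * n + 1" "set w \<subseteq> S"
    and m: "\<forall>x\<in>cylinder S w (- int n). c x = m" "n \<le> nat \<bar>m\<bar> + \<alpha> (nat \<bar>m\<bar>)"
    using la unfolding has_lookahead_def by metis
  \<comment> \<open>The periodic extension of \<open>w\<close>, aligned so that \<open>w\<close>
    occupies the positions from \<open>- n\<close> to \<open>n\<close>.\<close>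
  define x where "x = (\<lambda>i. w ! nat ((i + int n) mod int (2 * n + 1)))"
  have "nat ((i + int n) mod int (2 * n + 1)) < length w" for i
    unfolding w by (subst nat_less_iff) simp_all
  then have x: "x \<in> shift_space S" using w(2) by (auto simp: x_def shift_space_def)
  have "x \<in> cylinder S w (- int n)"
    using x unfolding cylinder_def w by (simp add: x_def)
  then have "c x = m" using m by blast
  moreover have "shiftpow (int (2 * n + 1)) x = x"
  proof
    fix i
    have "i + int (2 * n + 1) + int n = (i + int n) + int (2 * n + 1)" by simp
    then show "shiftpow (int (2 * n + 1)) x i = x i"
      unfolding shiftpow_def x_def by (simp only: mod_add_self2)
  qed
  ultimately show "\<exists>n\<ge>1. \<exists>x\<in>shift_space S. \<exists>p\<ge>1. p \<le> 2 * n + 1 \<and> shiftpow (int p) x = x \<and>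
      n \<le> nat \<bar>c x\<bar> + \<alpha> (nat \<bar>c x\<bar>)"
    using n x m(2) by (intro exI[of _ n] conjI bexI[of _ x] exI[of _ "2 * n + 1"]) simp_all
qed

lemma bounded_imp_linear: "bounded_fun \<alpha> \<Longrightarrow> linear_fun \<alpha>"
  unfolding bounded_fun_def linear_fun_def by (meson trans_le_add2)

lemma class_inclusions:
  shows "G_bnd S G \<Longrightarrow> G_pbnd S G" "G_bnd S G \<Longrightarrow> G_lin S G"
    "G_pbnd S G \<Longrightarrow> G_plin S G" "G_lin S G \<Longrightarrow> G_plin S G"
  unfolding G_bnd_def G_pbnd_def G_lin_def G_plin_def in_class_def
  using lookahead_imp_plookahead bounded_imp_linear by blast+

theorem mainTheorem4:
  fixes S :: "'a set" and G :: "('g, 'b) monoid_scheme"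
  assumes "alphabet S" and "group G"
  shows "G_bnd S G = G_pbnd S G \<and> G_pbnd S G = G_lin S G \<and> G_lin S G = G_plin S G \<and>
         G_plin S G = G_bnd_all G \<and> G_bnd_all G = G_pbnd_all G \<and>
         G_pbnd_all G = G_lin_all G \<and> G_lin_all G = G_plin_all G"
proof -
  have all: "G_bnd_all G" if "G_plin S G"
  proof -
    \<comment> \<open>Since the letters of \<open>S\<close> may have any type, the group is first
      moved to a binary alphabet of naturals, which witnesses the union.\<close>
    have "alphabet {0, 1 :: nat}" by (simp add: alphabet_def)
    then show ?thesis unfolding G_bnd_all_def using plin_imp_bnd[OF assms(1) _ that] by blast
  qed
  have from_all: "G_bnd S G" if "G_plin_all G"
    using that plin_imp_bnd[OF _ assms(1)] unfolding G_plin_all_def by blast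
  have "G_bnd_all G \<Longrightarrow> G_pbnd_all G" "G_bnd_all G \<Longrightarrow> G_lin_all G"
    "G_pbnd_all G \<Longrightarrow> G_plin_all G" "G_lin_all G \<Longrightarrow> G_plin_all G"
    unfolding G_bnd_all_def G_pbnd_all_def G_lin_all_def G_plin_all_def
    using class_inclusions by blast+
  then show ?thesis using all from_all class_inclusions[of S G] by blast
qed

end
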